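(* Let $\mathbf F:\mathbf X\to\mathbf Y$ be an omega pseudo-functor. Suppose that $\mathbf F$ is a weak equivalence and that $\mathbf X,\mathbf Y$ are $2$-skeletal. Then $F_1$ is a biequivalence between bicategories.
   Context: A globular set $X$ is a sequence of sets $X_i$ ($i\ge 0$; elements are called $i$-cells) with functions $dom_{i-1}^i,cod_{i-1}^i:X_i\to X_{i-1}$ ($i>0$) satisfying $dom_{i-1}^i dom_i^{i+1}=dom_{i-1}^i cod_i^{i+1}$ and $cod_{i-1}^i dom_i^{i+1}=cod_{i-1}^i cod_i^{i+1}$. For $i<j$, $dom_i^j,cod_i^j:X_j\to X_i$ are the iterated composites. An omega graph is a globular set with functions $id_i^{i-1}:X_{i-1}\to X_i$ ($i>0$) with $dom_{i-1}^i id_i^{i-1}x=x=cod_{i-1}^i id_i^{i-1}x$; $id_j^i$ denotes the iterated composite $X_i\to X_j$. Cells in the image of $id_i^{i-1}$ are identity cells; an omega graph is $n$-skeletal if every cell of dimension $>n$ is an identity cell. An omega magma is an omega graph with, for all $0\le i<j$, a partial binary operation $a\circ_i^j b$ on $j$-cells, defined exactly when $cod_i^j a=dom_i^j b$, such that: if $i+1=j$, then $dom_i^j(a\circ_i^j b)=dom_i^j a$ and $cod_i^j(a\circ_i^j b)=cod_i^j b$; if $i+1<j$, then $dom_{j-1}^j(a\circ_i^j b)=dom_{j-1}^ja\circ_i^{j-1}dom_{j-1}^jb$ and likewise for $cod_{j-1}^j$. Morphisms of globular sets, omega graphs and omega magmas preserve all the respective structure. A strict omega category is an omega magma in which (whenever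 the composites are defined) $(a\circ_i^jb)\circ_i^jc=a\circ_i^j(b\circ_i^jc)$; $(a\circ_j^kb)\circ_i^k(c\circ_j^kd)=(a\circ_i^kc)\circ_j^k(b\circ_i^kd)$ for $i<j<k$; $a=id_j^i(dom_i^ja)\circ_i^ja=a\circ_i^jid_j^i(cod_i^ja)$; and $id_{j+1}^j(a)\circ_i^{j+1}id_{j+1}^j(b)=id_{j+1}^j(a\circ_i^jb)$ for $i<j$. Two $i$-cells $a,b$ are parallel, $a\parallel b$, if they have the same $dom_{i-1}^i$ and the same $cod_{i-1}^i$; any two $0$-cells are parallel. A bridge relation $R$ on an omega graph (or omega magma) $X$ is a sequence $R_i\subseteq X_i\times X_i\times X_{i+1}$ ($i\ge0$) such that: $(a,b,c)\in R_i$ implies $a\parallel b$, $dom_i^{i+1}c=a$, $cod_i^{i+1}c=b$; $(a,a,id_{i+1}^ia)\in R_i$ for all $a\in X_i$; $(a,b,c),(a,b,d)\in R_i$ implies $c=d$. The diagonal bridge relation $R^\Delta$ consists of all triples $(a,a,id_{i+1}^ia)$. A bridge morphism $F:(X,R^X)\to(Y,R^Y)$ is an omega magma morphism with $(a,b,c)\in R_i^X\Rightarrow(Fa,Fb,Fc)\in R_i^Y$. A categorical Penon morphism is a bridge morphism $F:(X,R^X)\to(Y,R^Y)$ such that $Y$ is a strict omega category, $R^Y=R^\Delta$; $(a,b,c)\in R_i^X$ implies $Fa=Fb$ and $Fc=id_{i+1}^i(Fa)$; and if $a,b\in X_i$, $a\parallel b$, $Fa=Fb$, then there is $c$ with $(a,b,c)\in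 R_i^X$. A weak omega category $\mathbf X$ consists of omega magmas $X_1$ (the underlying magma) and $X_2$, an omega magma morphism $\lambda^X:X_2\to X_1$, a morphism $\rho^X:X_1\to X_2$ of omega graphs with $\lambda^X\circ\rho^X=1$ (as omega graph morphisms), a bridge relation $R^X$ on $X_2$, a strict omega category $X_3$, and a categorical Penon morphism $\kappa^X:(X_2,R^X)\to(X_3,R^\Delta)$. It is $n$-skeletal if $X_1$ is $n$-skeletal. An omega pseudo-functor $\mathbf F:\mathbf X\to\mathbf Y$ is a triple of morphisms of globular sets $F_i:X_i\to Y_i$ ($i=1,2,3$) such that $F_3$ is a morphism of omega graphs; $F_1\lambda^X=\lambda^YF_2$ and $F_3\kappa^X=\kappa^YF_2$ as morphisms of globular sets; and $\kappa^Y(F_2a\circ_{j-1}^jF_2b)=\kappa^YF_2(a\circ_{j-1}^jb)$ whenever $a\circ_{j-1}^jb$ is defined in $X_2$. If $\mathbf X$ is $2$-skeletal, $X_1$ is a bicategory: its objects, $1$-cells and $2$-cells are the $0$-, $1$-, $2$-cells of $X_1$; vertical composition is $\circ_1^2$, horizontal composition is $\circ_0^1$ on $1$-cells and $\circ_0^2$ on $2$-cells; identities are those of $X_1$; the associator component $f\circ_0^1(g\circ_0^1h)\to(f\circ_0^1g)\circ_0^1h$ is $\lambda^Xc$, where $c$ is the unique cell with $(\rho^Xf\circ_0^1(\rho^Xg\circ_0^1\rho^Xh),(\rho^Xf\circ_0^1\rho^Xg)\circ_0^1\rho^Xh,c)\in R_1^X$; the unit isomorphisms are likewise the images under $\lambda^X$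 of the bridge cells from $id_1^0(\rho^Xa)\circ_0^1\rho^Xf$, respectively $\rho^Xf\circ_0^1id_1^0(\rho^Xb)$, to $\rho^Xf$. For $\mathbf F$ an omega pseudo-functor between $2$-skeletal weak omega categories, $F_1$ is regarded as a homomorphism (pseudo-functor) of bicategories $X_1\to Y_1$ with coherence isomorphisms the images under $\lambda^Y$ of the bridge cells of $Y_2$ between $F_2\rho^Xf\circ_0^1F_2\rho^Xg$ and $F_2(\rho^Xf\circ_0^1\rho^Xg)$ and between $id_1^0(F_2\rho^Xa)$ and $F_2(id_1^0\rho^Xa)$. A biequivalence is a homomorphism that is surjective on objects up to equivalence and induces equivalences of hom-categories. Internal equivalences. An omega clique is an omega magma $M$ with a bridge relation $R^M$ such that for every parallel pair $a,b\in M_j$ there is $c$ with $(a,b,c)\in R_j^M$. Let $K(2)$ be the omega graph with exactly two $0$-cells $1,2$ and all other cells identities on these. $Cl(2)$ is the omega clique freely generated by $K(2)$: it comes with an omega graph morphism $K(2)\to Cl(2)$, and every omega graph morphism from $K(2)$ to an omega clique extends uniquely to a bridge morphism from $Cl(2)$. For $i,j\in\{1,2\}$ let $c(i,j)$ be the unique bridge $1$-cell from the $0$-cell $i$ to the $0$-cell $j$ given by the bridge relation of $Cl(2)$. For an omega magma $M$ and $(i-1)$-cells $a,b$, $M(a,b)$ is the omega magma with $M(a,b)_j=\{c\in M_{i+j}: dom_{i-1}^{i+j}c=a,\ cod_{i-1}^{i+j}c=b\}$ and structure that of $M$ restricted and reindexed. A $1$-cell $f$ of $M$ is an elementary internal equivalence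 if it is an identity cell or there is an omega magma morphism $H:Cl(2)\to M$ with $H(c(1,2))=f$; for $i\ge2$ an $i$-cell $f$ is one if it is an identity cell or there is an omega magma morphism $H:Cl(2)\to M(dom_{i-2}^if,cod_{i-2}^if)$ with $H(c(1,2))=f$. $el(M)$ is the graded subset of these ($el(M)_0=\emptyset$). For a graded subset $S\subseteq M$, $\overline S$ is the smallest graded subset containing all (iterated) composites of elements of $S$, including the elements of $S$; and $T(S)$ is the smallest graded subset containing, for every $k\ge1$, every $f\in M_k$ for which there are $g\in M_k$ with $dom_{k-1}^kg=cod_{k-1}^kf$, $cod_{k-1}^kg=dom_{k-1}^kf$, and $h,h'\in S$ with $dom_k^{k+1}h=f\circ_{k-1}^kg$, $cod_k^{k+1}h=id_k^{k-1}dom_{k-1}^kf$, $dom_k^{k+1}h'=g\circ_{k-1}^kf$, $cod_k^{k+1}h'=id_k^{k-1}cod_{k-1}^kf$. Put $S_1(M)=\overline{el(M)}$, $S_i(M)=\overline{S_{i-1}(M)\cup T(S_{i-1}(M))}$ for $i\ge2$, and $Eq(M)=\bigcup_{i\ge1}S_i(M)$, the graded subset of internal equivalences. Weak equivalences. An omega pseudo-functor $\mathbf F:\mathbf X\to\mathbf Y$ is tame if $F_1(Eq(X_1))\subseteq Eq(Y_1)$. For an omega magma $M$, let $\Pi M$ be the set of classes of $0$-cells of $M$ under the relation $a\approx b$ iff there is $f\in Eq(M)_1$ with $dom_0^1f=a$, $cod_0^1f=b$; put $\Pi\mathbf X=\Pi X_1$. For $(i-1)$-cells $a,b$ of $X_1$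 the hom weak omega category $\mathbf X(a,b)$ has underlying omega magma $X_1(a,b)$, so $\Pi\mathbf X(a,b)=\Pi(X_1(a,b))$, and $\mathbf F$ restricts to $\mathbf F(a,b):\mathbf X(a,b)\to\mathbf Y(F_1a,F_1b)$ with first component the restriction of $F_1$. The maps $\Pi\mathbf F:\Pi\mathbf X\to\Pi\mathbf Y$ and $\Pi\mathbf F(a,b):\Pi\mathbf X(a,b)\to\Pi\mathbf Y(F_1a,F_1b)$ are induced by $F_1$. A tame omega pseudo-functor $\mathbf F$ is a weak equivalence if $\Pi\mathbf F$ and $\Pi\mathbf F(a,b)$ are isomorphisms (bijections) for all $(i-1)$-cells $a,b$ of $X_1$ and all $i\ge1$.
   Formalization: Object surjectivity up to equivalence and hom-equivalences are proved outright; "biequivalence between bicategories" assumes the pentagon in X_1 and Y_1 and coherence (naturality, associators, units) of the comparison cells of F_1, which can fail under the given definitions. *)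

theory Defs
  imports Main
begin

section \<open>Globular sets, omega graphs, omega magmas\<close>

text \<open>
  The cells of all dimensions live in one type; the dimension is always passed explicitly, so cells
  of different dimensions are allowed to coincide as elements of that type.
  \<open>Dom X i\<close> and \<open>Cod X i\<close> map \<open>(i+1)\<close>-cells to \<open>i\<close>-cells, \<open>Idn X i\<close> maps \<open>i\<close>-cells to
  \<open>(i+1)\<close>-cells, and \<open>Cmp X i j\<close> is the composition of \<open>j\<close>-cells along an \<open>i\<close>-cell, in
  diagrammatic order. Operations are total functions whose values outside their domain of
  definition are never used.
\<close>

record 'a globular =
  Cells :: "nat \<Rightarrow> 'a set"
  Dom :: "nat \<Rightarrow> 'a \<Rightarrow> 'a"
  Cod :: "nat \<Rightarrow> 'a \<Rightarrow> 'a"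

record 'a omega_graph = "'a globular" +
  Idn :: "nat \<Rightarrow> 'a \<Rightarrow> 'a"

record 'a omega_magma = "'a omega_graph" +
  Cmp :: "nat \<Rightarrow> nat \<Rightarrow> 'a \<Rightarrow> 'a \<Rightarrow> 'a"

text \<open>Iterated domain, codomain and identity between dimensions \<open>i\<close> and \<open>j\<close>, \<open>i \<le> j\<close>.\<close>

primrec dom_it :: "('a, 'm) globular_scheme \<Rightarrow> nat \<Rightarrow> nat \<Rightarrow> 'a \<Rightarrow> 'a" where
  "dom_it X i 0 a = a"
| "dom_it X i (Suc j) a = (if i \<le> j then dom_it X i j (Dom X j a) else a)"

primrec cod_it :: "('a, 'm) globular_scheme \<Rightarrow> nat \<Rightarrow> nat \<Rightarrow> 'a \<Rightarrow> 'a" where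
  "cod_it X i 0 a = a"
| "cod_it X i (Suc j) a = (if i \<le> j then cod_it X i j (Cod X j a) else a)"

primrec id_it :: "('a, 'm) omega_graph_scheme \<Rightarrow> nat \<Rightarrow> nat \<Rightarrow> 'a \<Rightarrow> 'a" where
  "id_it X i 0 a = a"
| "id_it X i (Suc j) a = (if i \<le> j then Idn X j (id_it X i j a) else a)"

locale globular_set =
  fixes X :: "('a, 'm) globular_scheme" (structure)
  assumes Dom_cells: "a \<in> Cells X (Suc i) \<Longrightarrow> Dom X i a \<in> Cells X i"
    and Cod_cells: "a \<in> Cells X (Suc i) \<Longrightarrow> Cod X i a \<in> Cells X i"
    and Dom_Dom: "a \<in> Cells X (Suc (Suc i)) \<Longrightarrow>
      Dom X i (Dom X (Suc i) a) = Dom X i (Cod X (Suc i) a)"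
    and Cod_Dom: "a \<in> Cells X (Suc (Suc i)) \<Longrightarrow>
      Cod X i (Dom X (Suc i) a) = Cod X i (Cod X (Suc i) a)"

locale omega_graph = globular_set X for X :: "('a, 'm) omega_graph_scheme" (structure) +
  assumes Idn_cells: "a \<in> Cells X i \<Longrightarrow> Idn X i a \<in> Cells X (Suc i)"
    and Dom_Idn: "a \<in> Cells X i \<Longrightarrow> Dom X i (Idn X i a) = a"
    and Cod_Idn: "a \<in> Cells X i \<Longrightarrow> Cod X i (Idn X i a) = a"

definition composable :: "('a, 'm) globular_scheme \<Rightarrow> nat \<Rightarrow> nat \<Rightarrow> 'a \<Rightarrow> 'a \<Rightarrow> bool" where
  "composable X i j a b \<longleftrightarrow>
     i < j \<and> a \<in> Cells X j \<and> b \<in> Cells X j \<and> cod_it X i j a = dom_it X i j b"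

locale omega_magma = omega_graph X for X :: "('a, 'm) omega_magma_scheme" (structure) +
  assumes Cmp_cells: "composable X i j a b \<Longrightarrow> Cmp X i j a b \<in> Cells X j"
    and Dom_Cmp_top: "composable X i (Suc i) a b \<Longrightarrow> Dom X i (Cmp X i (Suc i) a b) = Dom X i a"
    and Cod_Cmp_top: "composable X i (Suc i) a b \<Longrightarrow> Cod X i (Cmp X i (Suc i) a b) = Cod X i b"
    and Dom_Cmp_low: "i < k \<Longrightarrow> composable X i (Suc k) a b \<Longrightarrow>
      Dom X k (Cmp X i (Suc k) a b) = Cmp X i k (Dom X k a) (Dom X k b)"
    and Cod_Cmp_low: "i < k \<Longrightarrow> composable X i (Suc k) a b \<Longrightarrow>
      Cod X k (Cmp X i (Suc k) a b) = Cmp X i k (Cod X k a) (Cod X k b)"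

locale strict_omega_category = omega_magma X for X :: "('a, 'm) omega_magma_scheme" (structure) +
  assumes Cmp_assoc: "composable X i j a b \<Longrightarrow> composable X i j b c \<Longrightarrow>
      Cmp X i j (Cmp X i j a b) c = Cmp X i j a (Cmp X i j b c)"
    and Cmp_interchange: "i < j \<Longrightarrow> j < k \<Longrightarrow>
      composable X j k a b \<Longrightarrow> composable X j k c d \<Longrightarrow>
      composable X i k a c \<Longrightarrow> composable X i k b d \<Longrightarrow>
      Cmp X i k (Cmp X j k a b) (Cmp X j k c d) = Cmp X j k (Cmp X i k a c) (Cmp X i k b d)"
    and Cmp_id_left: "i < j \<Longrightarrow> a \<in> Cells X j \<Longrightarrow>
      Cmp X i j (id_it X i j (dom_it X i j a)) a = a"
    and Cmp_id_right: "i < j \<Longrightarrow> a \<in> Cells X j \<Longrightarrow>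
      Cmp X i j a (id_it X i j (cod_it X i j a)) = a"
    and Cmp_Idn: "composable X i j a b \<Longrightarrow>
      Cmp X i (Suc j) (Idn X j a) (Idn X j b) = Idn X j (Cmp X i j a b)"

definition identity_cells :: "('a, 'm) omega_graph_scheme \<Rightarrow> nat \<Rightarrow> 'a set" where
  "identity_cells X k = (case k of 0 \<Rightarrow> {} | Suc i \<Rightarrow> Idn X i ` Cells X i)"

definition skeletal :: "nat \<Rightarrow> ('a, 'm) omega_graph_scheme \<Rightarrow> bool" where
  "skeletal n X \<longleftrightarrow> (\<forall>k>n. Cells X k \<subseteq> identity_cells X k)"

definition parallel :: "('a, 'm) globular_scheme \<Rightarrow> nat \<Rightarrow> 'a \<Rightarrow> 'a \<Rightarrow> bool" where
  "parallel X i a b \<longleftrightarrow> a \<in> Cells X i \<and> b \<in> Cells X i \<and>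
     (case i of 0 \<Rightarrow> True | Suc k \<Rightarrow> Dom X k a = Dom X k b \<and> Cod X k a = Cod X k b)"

definition globular_morphism ::
  "('a, 'm) globular_scheme \<Rightarrow> ('b, 'n) globular_scheme \<Rightarrow> (nat \<Rightarrow> 'a \<Rightarrow> 'b) \<Rightarrow> bool" where
  "globular_morphism X Y F \<longleftrightarrow>
     (\<forall>i. \<forall>a \<in> Cells X i. F i a \<in> Cells Y i) \<and>
     (\<forall>i. \<forall>a \<in> Cells X (Suc i). F i (Dom X i a) = Dom Y i (F (Suc i) a)) \<and>
     (\<forall>i. \<forall>a \<in> Cells X (Suc i). F i (Cod X i a) = Cod Y i (F (Suc i) a))"

definition graph_morphism ::
  "('a, 'm) omega_graph_scheme \<Rightarrow> ('b, 'n) omega_graph_scheme \<Rightarrow> (nat \<Rightarrow> 'a \<Rightarrow> 'b) \<Rightarrow> bool" where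
  "graph_morphism X Y F \<longleftrightarrow> globular_morphism X Y F \<and>
     (\<forall>i. \<forall>a \<in> Cells X i. F (Suc i) (Idn X i a) = Idn Y i (F i a))"

definition magma_morphism ::
  "('a, 'm) omega_magma_scheme \<Rightarrow> ('b, 'n) omega_magma_scheme \<Rightarrow> (nat \<Rightarrow> 'a \<Rightarrow> 'b) \<Rightarrow> bool" where
  "magma_morphism X Y F \<longleftrightarrow> graph_morphism X Y F \<and>
     (\<forall>i j a b. composable X i j a b \<longrightarrow> F j (Cmp X i j a b) = Cmp Y i j (F j a) (F j b))"


section \<open>Bridge relations and weak omega categories\<close>

type_synonym 'a bridge = "nat \<Rightarrow> ('a \<times> 'a \<times> 'a) set"

locale bridge_relation =
  fixes X :: "('a, 'm) omega_graph_scheme" (structure) and R :: "'a bridge"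
  assumes bridge_parallel: "(a, b, c) \<in> R i \<Longrightarrow> parallel X i a b"
    and bridge_cells: "(a, b, c) \<in> R i \<Longrightarrow> c \<in> Cells X (Suc i)"
    and bridge_Dom: "(a, b, c) \<in> R i \<Longrightarrow> Dom X i c = a"
    and bridge_Cod: "(a, b, c) \<in> R i \<Longrightarrow> Cod X i c = b"
    and bridge_refl: "a \<in> Cells X i \<Longrightarrow> (a, a, Idn X i a) \<in> R i"
    and bridge_unique: "(a, b, c) \<in> R i \<Longrightarrow> (a, b, d) \<in> R i \<Longrightarrow> c = d"

definition diagonal_bridge :: "('a, 'm) omega_graph_scheme \<Rightarrow> 'a bridge" where
  "diagonal_bridge X i = {(a, a, Idn X i a) | a. a \<in> Cells X i}"

text \<open>The bridge cell from \<open>a\<close> to \<open>b\<close>, meaningful only if there is one.\<close>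

definition bridge_cell :: "'a bridge \<Rightarrow> nat \<Rightarrow> 'a \<Rightarrow> 'a \<Rightarrow> 'a" where
  "bridge_cell R i a b = (THE c. (a, b, c) \<in> R i)"

definition bridge_morphism ::
  "('a, 'm) omega_magma_scheme \<Rightarrow> 'a bridge \<Rightarrow> ('b, 'n) omega_magma_scheme \<Rightarrow> 'b bridge \<Rightarrow>
   (nat \<Rightarrow> 'a \<Rightarrow> 'b) \<Rightarrow> bool" where
  "bridge_morphism X R Y S F \<longleftrightarrow> magma_morphism X Y F \<and>
     (\<forall>i a b c. (a, b, c) \<in> R i \<longrightarrow> (F i a, F i b, F (Suc i) c) \<in> S i)"

definition penon_morphism ::
  "('a, 'm) omega_magma_scheme \<Rightarrow> 'a bridge \<Rightarrow> ('b, 'n) omega_magma_scheme \<Rightarrow> 'b bridge \<Rightarrow>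
   (nat \<Rightarrow> 'a \<Rightarrow> 'b) \<Rightarrow> bool" where
  "penon_morphism X R Y S F \<longleftrightarrow>
     bridge_morphism X R Y S F \<and> strict_omega_category Y \<and> S = diagonal_bridge Y \<and>
     (\<forall>i a b c. (a, b, c) \<in> R i \<longrightarrow> F i a = F i b \<and> F (Suc i) c = Idn Y i (F i a)) \<and>
     (\<forall>i a b. parallel X i a b \<and> F i a = F i b \<longrightarrow> (\<exists>c. (a, b, c) \<in> R i))"

record ('a, 'b, 'c) weak_omega_cat =
  M1 :: "'a omega_magma"
  M2 :: "'b omega_magma"
  M3 :: "'c omega_magma"
  lam :: "nat \<Rightarrow> 'b \<Rightarrow> 'a"
  rho :: "nat \<Rightarrow> 'a \<Rightarrow> 'b"
  kap :: "nat \<Rightarrow> 'b \<Rightarrow> 'c"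
  bridge :: "'b bridge"

locale weak_omega_category =
  fixes X :: "('a, 'b, 'c) weak_omega_cat" (structure)
  assumes M1: "omega_magma (M1 X)"
    and M2: "omega_magma (M2 X)"
    and M3: "strict_omega_category (M3 X)"
    and lam: "magma_morphism (M2 X) (M1 X) (lam X)"
    and rho: "graph_morphism (M1 X) (M2 X) (rho X)"
    and lam_rho: "a \<in> Cells (M1 X) i \<Longrightarrow> lam X i (rho X i a) = a"
    and bridge: "bridge_relation (M2 X) (bridge X)"
    and kap: "penon_morphism (M2 X) (bridge X) (M3 X) (diagonal_bridge (M3 X)) (kap X)"

record ('a, 'b, 'c, 'd, 'e, 'f) pseudofunctor =
  F1 :: "nat \<Rightarrow> 'a \<Rightarrow> 'd"
  F2 :: "nat \<Rightarrow> 'b \<Rightarrow> 'e"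
  F3 :: "nat \<Rightarrow> 'c \<Rightarrow> 'f"

locale omega_pseudofunctor = X: weak_omega_category X + Y: weak_omega_category Y
  for X :: "('a, 'b, 'c) weak_omega_cat" and Y :: "('d, 'e, 'f) weak_omega_cat"
    and F :: "('a, 'b, 'c, 'd, 'e, 'f) pseudofunctor" +
  assumes F1: "globular_morphism (M1 X) (M1 Y) (F1 F)"
    and F2: "globular_morphism (M2 X) (M2 Y) (F2 F)"
    and F3: "graph_morphism (M3 X) (M3 Y) (F3 F)"
    and F_lam: "a \<in> Cells (M2 X) i \<Longrightarrow> F1 F i (lam X i a) = lam Y i (F2 F i a)"
    and F_kap: "a \<in> Cells (M2 X) i \<Longrightarrow> F3 F i (kap X i a) = kap Y i (F2 F i a)"
    and kap_F_Cmp: "composable (M2 X) i (Suc i) a b \<Longrightarrow>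
      kap Y (Suc i) (Cmp (M2 Y) i (Suc i) (F2 F (Suc i) a) (F2 F (Suc i) b)) =
      kap Y (Suc i) (F2 F (Suc i) (Cmp (M2 X) i (Suc i) a b))"


section \<open>The omega clique freely generated by two objects\<close>

definition omega_clique :: "('a, 'm) omega_magma_scheme \<Rightarrow> 'a bridge \<Rightarrow> bool" where
  "omega_clique M R \<longleftrightarrow> omega_magma M \<and> bridge_relation M R \<and>
     (\<forall>i a b. parallel M i a b \<longrightarrow> (\<exists>c. (a, b, c) \<in> R i))"

datatype two = One | Two

definition K2 :: "two omega_graph" where
  "K2 = \<lparr>Cells = (\<lambda>i. UNIV), Dom = (\<lambda>i p. p), Cod = (\<lambda>i p. p), Idn = (\<lambda>i p. p)\<rparr>"

text \<open>
  The free clique is built from formal terms. Bridge cells \<open>Br a b\<close> are formed only for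
  \<open>a \<noteq> b\<close>, because the bridge cell from \<open>a\<close> to itself is the identity. The universal property is
  theorem \<open>Cl2_free\<close> below.
\<close>

datatype cl2 = Pt two | Idt cl2 | Br cl2 cl2 | Cp nat cl2 cl2

primrec tdim :: "cl2 \<Rightarrow> nat" where
  "tdim (Pt p) = 0"
| "tdim (Idt t) = Suc (tdim t)"
| "tdim (Br a b) = Suc (tdim a)"
| "tdim (Cp i a b) = tdim a"

primrec tdom :: "cl2 \<Rightarrow> cl2" where
  "tdom (Pt p) = Pt p"
| "tdom (Idt t) = t"
| "tdom (Br a b) = a"
| "tdom (Cp i a b) = (if Suc i = tdim a then tdom a else Cp i (tdom a) (tdom b))"

primrec tcod :: "cl2 \<Rightarrow> cl2" where
  "tcod (Pt p) = Pt p"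
| "tcod (Idt t) = t"
| "tcod (Br a b) = b"
| "tcod (Cp i a b) = (if Suc i = tdim a then tcod b else Cp i (tcod a) (tcod b))"

inductive twf :: "cl2 \<Rightarrow> bool" where
  Pt: "twf (Pt p)"
| Idt: "twf t \<Longrightarrow> twf (Idt t)"
| Br: "twf a \<Longrightarrow> twf b \<Longrightarrow> tdim a = tdim b \<Longrightarrow>
    tdim a = 0 \<or> tdom a = tdom b \<and> tcod a = tcod b \<Longrightarrow> a \<noteq> b \<Longrightarrow> twf (Br a b)"
| Cp: "twf a \<Longrightarrow> twf b \<Longrightarrow> tdim a = tdim b \<Longrightarrow> i < tdim a \<Longrightarrow>
    (tcod ^^ (tdim a - i)) a = (tdom ^^ (tdim a - i)) b \<Longrightarrow> twf (Cp i a b)"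

definition Cl2 :: "cl2 omega_magma" where
  "Cl2 = \<lparr>Cells = (\<lambda>k. {t. twf t \<and> tdim t = k}), Dom = (\<lambda>k. tdom), Cod = (\<lambda>k. tcod),
          Idn = (\<lambda>k. Idt), Cmp = (\<lambda>i j. Cp i)\<rparr>"

definition Cl2_bridge :: "cl2 bridge" where
  "Cl2_bridge k = {(a, b, if a = b then Idt a else Br a b) | a b. parallel Cl2 k a b}"

definition Cl2_incl :: "nat \<Rightarrow> two \<Rightarrow> cl2" where
  "Cl2_incl k p = (Idt ^^ k) (Pt p)"

definition Cl2_c :: "two \<Rightarrow> two \<Rightarrow> cl2" where
  "Cl2_c p q = bridge_cell Cl2_bridge 0 (Pt p) (Pt q)"

lemma Cl2_simps [simp]:
  "t \<in> Cells Cl2 k \<longleftrightarrow> twf t \<and> tdim t = k"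
  "Dom Cl2 k = tdom" "Cod Cl2 k = tcod" "Idn Cl2 k = Idt" "Cmp Cl2 i j = Cp i"
  by (simp_all add: Cl2_def)

lemma twf_boundary:
  assumes "twf t"
  shows "(tdim t = Suc k \<longrightarrow> twf (tdom t) \<and> twf (tcod t) \<and> tdim (tdom t) = k \<and> tdim (tcod t) = k) \<and>
    (tdim t = Suc (Suc m) \<longrightarrow> tdom (tdom t) = tdom (tcod t) \<and> tcod (tdom t) = tcod (tcod t))"
  using assms
proof (induction t arbitrary: k m)
  case (Cp a b i)
  have da: "twf (tdom a)" "twf (tcod a)" "tdim (tdom a) = tdim a - 1" "tdim (tcod a) = tdim a - 1"
    using Cp.IH(1)[of "tdim a - 1"] Cp.hyps(4) by auto
  have db: "twf (tdom b)" "twf (tcod b)" "tdim (tdom b) = tdim a - 1" "tdim (tcod b) = tdim a - 1"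
    using Cp.IH(2)[of "tdim a - 1"] Cp.hyps(3,4) by auto
  have ga: "tdom (tdom a) = tdom (tcod a)" "tcod (tdom a) = tcod (tcod a)" if "1 < tdim a"
    using Cp.IH(1)[of 0 "tdim a - 2"] that by auto
  have gb: "tdom (tdom b) = tdom (tcod b)" "tcod (tdom b) = tcod (tcod b)" if "1 < tdim a"
    using Cp.IH(2)[of 0 "tdim a - 2"] that Cp.hyps(3) by auto
  show ?case
  proof (cases "Suc i = tdim a")
    case True
    then have "tdim a - i = Suc 0" by simp
    then have m: "tcod a = tdom b" using Cp.hyps(5) by simp
    show ?thesis using True da db ga gb m by auto
  next
    case False
    then have lt: "Suc i < tdim a" using Cp.hyps(4) by simp
    then obtain n where n: "tdim a - i = Suc (Suc n)"
      by (metis Suc_diff_Suc Suc_lessD)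
    have n': "tdim a - 1 - i = Suc n" using n by simp
    have c: "(tcod ^^ Suc n) (tcod a) = (tdom ^^ Suc n) (tdom b)"
      using Cp.hyps(5) unfolding n by (simp only: funpow_Suc_right o_apply)
    have c1: "(tcod ^^ Suc n) (tdom a) = (tdom ^^ Suc n) (tdom b)"
      using c ga lt by (simp only: funpow_Suc_right o_apply)
    have c2: "(tcod ^^ Suc n) (tcod a) = (tdom ^^ Suc n) (tcod b)"
      using c gb lt by (simp only: funpow_Suc_right o_apply)
    have w1: "twf (Cp i (tdom a) (tdom b))"
      using da db lt c1 n' by (intro twf.Cp) (auto simp del: funpow.simps)
    have w2: "twf (Cp i (tcod a) (tcod b))"
      using da db lt c2 n' by (intro twf.Cp) (auto simp del: funpow.simps)
    show ?thesis using False w1 w2 da db ga gb lt by auto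
  qed
qed (auto intro: twf.intros)

lemma dom_it_Cl2: "i \<le> j \<Longrightarrow> dom_it Cl2 i j t = (tdom ^^ (j - i)) t"
proof (induction j arbitrary: t)
  case (Suc j)
  then show ?case
    by (cases "i \<le> j") (auto simp: Suc_diff_le funpow_swap1 simp flip: funpow_Suc_right)
qed simp

lemma cod_it_Cl2: "i \<le> j \<Longrightarrow> cod_it Cl2 i j t = (tcod ^^ (j - i)) t"
proof (induction j arbitrary: t)
  case (Suc j)
  then show ?case
    by (cases "i \<le> j") (auto simp: Suc_diff_le funpow_swap1 simp flip: funpow_Suc_right)
qed simp

lemma composable_Cl2:
  "composable Cl2 i j a b \<longleftrightarrow> twf (Cp i a b) \<and> tdim a = j"
  by (auto simp: composable_def dom_it_Cl2 cod_it_Cl2 intro: twf.Cp elim: twf.cases)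

lemma parallel_Cl2:
  "parallel Cl2 k a b \<longleftrightarrow> twf a \<and> twf b \<and> tdim a = k \<and> tdim b = k \<and>
     (k = 0 \<or> tdom a = tdom b \<and> tcod a = tcod b)"
  by (cases k) (auto simp: parallel_def)

lemma Cl2_magma: "omega_magma Cl2"
proof unfold_locales
  fix i a b
  show "composable Cl2 i (Suc i) a b \<Longrightarrow> Dom Cl2 i (Cmp Cl2 i (Suc i) a b) = Dom Cl2 i a"
    "composable Cl2 i (Suc i) a b \<Longrightarrow> Cod Cl2 i (Cmp Cl2 i (Suc i) a b) = Cod Cl2 i b"
    by (auto simp: composable_Cl2)
qed (use twf_boundary in \<open>auto simp: composable_Cl2 intro: twf.intros\<close>)

lemma Cl2_bridge_relation: "bridge_relation Cl2 Cl2_bridge"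
proof unfold_locales
  fix a b c d i
  show "(a, b, c) \<in> Cl2_bridge i \<Longrightarrow> c \<in> Cells Cl2 (Suc i)"
    using twf.Br[of a b] twf.Idt[of a] by (auto simp: Cl2_bridge_def parallel_Cl2)
qed (auto simp: Cl2_bridge_def parallel_Cl2 split: if_splits)

lemma Cl2_clique: "omega_clique Cl2 Cl2_bridge"
  using Cl2_magma Cl2_bridge_relation by (auto simp: omega_clique_def Cl2_bridge_def)

lemma Cl2_incl_morphism: "graph_morphism K2 Cl2 Cl2_incl"
proof -
  have "twf (Cl2_incl k p) \<and> tdim (Cl2_incl k p) = k" for k p
    by (induction k) (simp_all add: Cl2_incl_def twf.Pt twf.Idt)
  then show ?thesis
    by (auto simp: graph_morphism_def globular_morphism_def K2_def Cl2_incl_def)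
qed

lemma bridge_cell_eq: "bridge_relation X R \<Longrightarrow> (a, b, c) \<in> R i \<Longrightarrow> bridge_cell R i a b = c"
  unfolding bridge_cell_def by (blast intro: bridge_relation.bridge_unique)

lemma Cl2_c_eq: "p \<noteq> q \<Longrightarrow> Cl2_c p q = Br (Pt p) (Pt q)" "Cl2_c p p = Idt (Pt p)"
  unfolding Cl2_c_def
  by (rule bridge_cell_eq[OF Cl2_bridge_relation],
      auto simp: Cl2_bridge_def parallel_Cl2 twf.Pt)+

primrec Cl2_ext :: "('a, 'm) omega_magma_scheme \<Rightarrow> 'a bridge \<Rightarrow> (two \<Rightarrow> 'a) \<Rightarrow> cl2 \<Rightarrow> 'a" where
  "Cl2_ext M R g (Pt p) = g p"
| "Cl2_ext M R g (Idt t) = Idn M (tdim t) (Cl2_ext M R g t)"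
| "Cl2_ext M R g (Br a b) = bridge_cell R (tdim a) (Cl2_ext M R g a) (Cl2_ext M R g b)"
| "Cl2_ext M R g (Cp i a b) = Cmp M i (tdim a) (Cl2_ext M R g a) (Cl2_ext M R g b)"

lemma size_boundary: "size (tdom t) \<le> size t" "size (tcod t) \<le> size t"
  by (induction t) auto

definition Cl2_ext_ok :: "('a, 'm) omega_magma_scheme \<Rightarrow> 'a bridge \<Rightarrow> (two \<Rightarrow> 'a) \<Rightarrow> cl2 \<Rightarrow> bool" where
  "Cl2_ext_ok M R g t \<longleftrightarrow> Cl2_ext M R g t \<in> Cells M (tdim t) \<and>
     (\<forall>k. tdim t = Suc k \<longrightarrow> Dom M k (Cl2_ext M R g t) = Cl2_ext M R g (tdom t) \<and>
        Cod M k (Cl2_ext M R g t) = Cl2_ext M R g (tcod t))"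

lemma Cl2_ext_it:
  assumes "\<And>t. twf t \<Longrightarrow> size t \<le> n \<Longrightarrow> Cl2_ext_ok M R g t"
    and "twf t" "tdim t = j" "i \<le> j" "size t \<le> n"
  shows "dom_it M i j (Cl2_ext M R g t) = Cl2_ext M R g ((tdom ^^ (j - i)) t) \<and>
    cod_it M i j (Cl2_ext M R g t) = Cl2_ext M R g ((tcod ^^ (j - i)) t)"
  using assms(2-)
proof (induction j arbitrary: t)
  case (Suc j)
  have ok: "Cl2_ext_ok M R g t" using assms(1) Suc.prems by blast
  have b: "twf (tdom t)" "tdim (tdom t) = j" "twf (tcod t)" "tdim (tcod t) = j"
    using twf_boundary Suc.prems by blast+
  show ?case
  proof (cases "i \<le> j")
    case True
    then have "dom_it M i j (Cl2_ext M R g (tdom t)) = Cl2_ext M R g ((tdom ^^ (j - i)) (tdom t))"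
      "cod_it M i j (Cl2_ext M R g (tcod t)) = Cl2_ext M R g ((tcod ^^ (j - i)) (tcod t))"
      using Suc.IH[of "tdom t"] Suc.IH[of "tcod t"] b Suc.prems(4) size_boundary[of t] by auto
    then show ?thesis
      using ok True Suc.prems(2) by (simp add: Cl2_ext_ok_def Suc_diff_le funpow_swap1)
  qed (use Suc.prems in \<open>simp add: le_Suc_eq\<close>)
qed simp

lemma omega_clique_bridge: "omega_clique M R \<Longrightarrow> parallel M i a b \<Longrightarrow> \<exists>c. (a, b, c) \<in> R i"
  by (simp add: omega_clique_def)

lemma Cl2_ext_ok:
  assumes "omega_clique M R" and g: "\<And>p. g p \<in> Cells M 0" and "twf t"
  shows "Cl2_ext_ok M R g t"
  using \<open>twf t\<close>
proof (induction t rule: measure_induct_rule[of size])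
  case (less t)
  interpret M: omega_magma M using assms by (simp add: omega_clique_def)
  interpret R: bridge_relation M R using assms by (simp add: omega_clique_def)
  show ?case
    using \<open>twf t\<close>
  proof cases
    case (Pt p)
    then show ?thesis using g by (simp add: Cl2_ext_ok_def)
  next
    case (Idt s)
    then have "Cl2_ext_ok M R g s" using less.IH by simp
    then show ?thesis
      using Idt by (auto simp: Cl2_ext_ok_def M.Idn_cells M.Dom_Idn M.Cod_Idn)
  next
    case (Br a b)
    have ab: "Cl2_ext_ok M R g a" "Cl2_ext_ok M R g b" using Br less.IH by auto
    have "parallel M (tdim a) (Cl2_ext M R g a) (Cl2_ext M R g b)"
      using ab Br by (auto simp: parallel_def Cl2_ext_ok_def split: nat.split)
    then obtain c where c: "(Cl2_ext M R g a, Cl2_ext M R g b, c) \<in> R (tdim a)"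
      by (rule omega_clique_bridge[OF assms(1), THEN exE])
    then have "bridge_cell R (tdim a) (Cl2_ext M R g a) (Cl2_ext M R g b) = c"
      by (rule bridge_cell_eq[OF R.bridge_relation_axioms])
    then show ?thesis
      using Br R.bridge_cells[OF c] R.bridge_Dom[OF c] R.bridge_Cod[OF c]
      by (simp add: Cl2_ext_ok_def)
  next
    case (Cp a b i)
    have IH: "\<And>s. twf s \<Longrightarrow> size s \<le> max (size a) (size b) \<Longrightarrow> Cl2_ext_ok M R g s"
      using less.IH Cp(1) by auto
    have ab: "Cl2_ext_ok M R g a" "Cl2_ext_ok M R g b" using IH Cp by auto
    have "cod_it M i (tdim a) (Cl2_ext M R g a) = dom_it M i (tdim a) (Cl2_ext M R g b)"
      using Cl2_ext_it[OF IH, where t = a and j = "tdim a" and i = i]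
        Cl2_ext_it[OF IH, where t = b and j = "tdim a" and i = i] Cp by simp
    then have comp: "composable M i (tdim a) (Cl2_ext M R g a) (Cl2_ext M R g b)"
      using ab Cp by (auto simp: composable_def Cl2_ext_ok_def)
    have "Dom M k (Cl2_ext M R g t) = Cl2_ext M R g (tdom t) \<and>
        Cod M k (Cl2_ext M R g t) = Cl2_ext M R g (tcod t)" if k: "tdim a = Suc k" for k
    proof (cases "i = k")
      case True
      then show ?thesis
        using comp k ab Cp M.Dom_Cmp_top[of k] M.Cod_Cmp_top[of k] by (simp add: Cl2_ext_ok_def)
    next
      case False
      then have "i < k" using k Cp by simp
      then show ?thesis
        using comp k ab Cp M.Dom_Cmp_low[of i k] M.Cod_Cmp_low[of i k]
          twf_boundary[of a k] twf_boundary[of b k]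
        by (simp add: Cl2_ext_ok_def)
    qed
    then show ?thesis using M.Cmp_cells[OF comp] Cp by (simp add: Cl2_ext_ok_def)
  qed
qed

theorem Cl2_free:
  assumes MR: "omega_clique M R" and G: "graph_morphism K2 M G"
  shows "\<exists>H. bridge_morphism Cl2 Cl2_bridge M R H \<and> (\<forall>k p. H k (Cl2_incl k p) = G k p)"
    and "\<lbrakk>bridge_morphism Cl2 Cl2_bridge M R H; \<forall>k p. H k (Cl2_incl k p) = G k p;
      bridge_morphism Cl2 Cl2_bridge M R H'; \<forall>k p. H' k (Cl2_incl k p) = G k p;
      t \<in> Cells Cl2 k\<rbrakk> \<Longrightarrow> H k t = H' k t"
proof -
  interpret M: omega_magma M using MR by (simp add: omega_clique_def)
  interpret R: bridge_relation M R using MR by (simp add: omega_clique_def)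
  let ?e = "Cl2_ext M R (G 0)"
  have "\<forall>i. \<forall>p \<in> Cells K2 i. G i p \<in> Cells M i"
    "\<forall>i. \<forall>p \<in> Cells K2 i. G (Suc i) (Idn K2 i p) = Idn M i (G i p)"
    using G unfolding graph_morphism_def globular_morphism_def by blast+
  then have G0: "G 0 p \<in> Cells M 0" and GS: "G (Suc i) p = Idn M i (G i p)" for i p
    by (simp_all add: K2_def)
  have ok: "Cl2_ext_ok M R (G 0) t" if "twf t" for t
    using Cl2_ext_ok[OF MR G0 that] .
  have "magma_morphism Cl2 M (\<lambda>k. ?e)"
    unfolding magma_morphism_def graph_morphism_def globular_morphism_def
    using ok by (intro conjI allI ballI impI) (auto simp: Cl2_ext_ok_def composable_Cl2)
  moreover have "(?e a, ?e b, ?e c) \<in> R i" if "(a, b, c) \<in> Cl2_bridge i" for a b c i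
  proof -
    have p: "parallel Cl2 i a b" and c: "c = (if a = b then Idt a else Br a b)"
      using that by (auto simp: Cl2_bridge_def)
    have w: "twf a" "twf b" "tdim a = i" "tdim b = i" using p by (auto simp: parallel_Cl2)
    show ?thesis
    proof (cases "a = b")
      case True
      then show ?thesis using c w ok[of a] R.bridge_refl by (auto simp: Cl2_ext_ok_def)
    next
      case False
      have "parallel M i (?e a) (?e b)"
        using p ok[of a] ok[of b]
        by (auto simp: parallel_def Cl2_ext_ok_def split: nat.splits)
      then obtain d where "(?e a, ?e b, d) \<in> R i"
        by (rule omega_clique_bridge[OF MR, THEN exE])
      then show ?thesis
        using bridge_cell_eq[OF R.bridge_relation_axioms] False c w by simp
    qed
  qed
  moreover have "?e (Cl2_incl k p) = G k p" for k p
  proof (induction k)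
    case (Suc k)
    have "tdim (Cl2_incl k p) = k" by (induction k) (auto simp: Cl2_incl_def)
    then show ?case using Suc GS[of k p] by (simp add: Cl2_incl_def)
  qed (simp add: Cl2_incl_def)
  ultimately show "\<exists>H. bridge_morphism Cl2 Cl2_bridge M R H \<and> (\<forall>k p. H k (Cl2_incl k p) = G k p)"
    unfolding bridge_morphism_def by blast
  assume H: "bridge_morphism Cl2 Cl2_bridge M R H" "\<forall>k p. H k (Cl2_incl k p) = G k p"
    and H': "bridge_morphism Cl2 Cl2_bridge M R H'" "\<forall>k p. H' k (Cl2_incl k p) = G k p"
  have *: "twf t \<Longrightarrow> H (tdim t) t = H' (tdim t) t" for t
  proof (induction rule: twf.induct)
    case (Pt p)
    then show ?case using H(2)[rule_format, of 0 p] H'(2)[rule_format, of 0 p]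
      by (simp add: Cl2_incl_def)
  next
    case (Idt t)
    then show ?case
      using H(1) H'(1) unfolding bridge_morphism_def magma_morphism_def graph_morphism_def by simp
  next
    case (Br a b)
    then have "(a, b, Br a b) \<in> Cl2_bridge (tdim a)"
      by (auto simp: Cl2_bridge_def parallel_Cl2)
    then have "(H (tdim a) a, H (tdim a) b, H (Suc (tdim a)) (Br a b)) \<in> R (tdim a)"
      "(H' (tdim a) a, H' (tdim a) b, H' (Suc (tdim a)) (Br a b)) \<in> R (tdim a)"
      using H(1) H'(1) unfolding bridge_morphism_def by blast+
    then show ?case using Br R.bridge_unique by fastforce
  next
    case (Cp a b i)
    then have "composable Cl2 i (tdim a) a b" by (auto simp: composable_Cl2 intro: twf.Cp)
    then have "H (tdim a) (Cp i a b) = Cmp M i (tdim a) (H (tdim a) a) (H (tdim a) b)"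
      "H' (tdim a) (Cp i a b) = Cmp M i (tdim a) (H' (tdim a) a) (H' (tdim a) b)"
      using H(1) H'(1) unfolding bridge_morphism_def magma_morphism_def Cl2_simps by blast+
    then show ?case using Cp by simp
  qed
  assume "t \<in> Cells Cl2 k"
  then show "H k t = H' k t" using *[of t] by auto
qed


section \<open>Internal equivalences\<close>

text \<open>\<open>hom_magma M m a b\<close> is the omega magma \<open>M(a,b)\<close> for \<open>m\<close>-cells \<open>a\<close>, \<open>b\<close>; its \<open>j\<close>-cells are
  \<open>(m+1+j)\<close>-cells of \<open>M\<close>.\<close>

definition hom_magma :: "'a omega_magma \<Rightarrow> nat \<Rightarrow> 'a \<Rightarrow> 'a \<Rightarrow> 'a omega_magma" where
  "hom_magma M m a b =
     \<lparr>Cells = (\<lambda>j. {c \<in> Cells M (Suc m + j).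
                     dom_it M m (Suc m + j) c = a \<and> cod_it M m (Suc m + j) c = b}),
      Dom = (\<lambda>j. Dom M (Suc m + j)),
      Cod = (\<lambda>j. Cod M (Suc m + j)),
      Idn = (\<lambda>j. Idn M (Suc m + j)),
      Cmp = (\<lambda>i j. Cmp M (Suc m + i) (Suc m + j))\<rparr>"

definition el :: "'a omega_magma \<Rightarrow> nat \<Rightarrow> 'a set" where
  "el M k = (case k of
       0 \<Rightarrow> {}
     | Suc 0 \<Rightarrow> {f \<in> Cells M 1. f \<in> identity_cells M 1 \<or>
         (\<exists>H. magma_morphism Cl2 M H \<and> H 1 (Cl2_c One Two) = f)}
     | Suc (Suc m) \<Rightarrow> {f \<in> Cells M k. f \<in> identity_cells M k \<or>
         (\<exists>H. magma_morphism Cl2 (hom_magma M m (dom_it M m k f) (cod_it M m k f)) H \<and>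
              H 1 (Cl2_c One Two) = f)})"

inductive_set composites :: "'a omega_magma \<Rightarrow> (nat \<Rightarrow> 'a set) \<Rightarrow> nat \<Rightarrow> 'a set"
  for M :: "'a omega_magma" and S :: "nat \<Rightarrow> 'a set" and k :: nat where
  base: "f \<in> S k \<Longrightarrow> f \<in> composites M S k"
| Cmp: "f \<in> composites M S k \<Longrightarrow> g \<in> composites M S k \<Longrightarrow> composable M i k f g \<Longrightarrow>
    Cmp M i k f g \<in> composites M S k"

definition invertible_up_to :: "'a omega_magma \<Rightarrow> (nat \<Rightarrow> 'a set) \<Rightarrow> nat \<Rightarrow> 'a set" where
  "invertible_up_to M S k = (case k of 0 \<Rightarrow> {} | Suc m \<Rightarrow>
     {f \<in> Cells M k. \<exists>g \<in> Cells M k. Dom M m g = Cod M m f \<and> Cod M m g = Dom M m f \<and>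
        (\<exists>h \<in> S (Suc k). \<exists>h' \<in> S (Suc k).
           Dom M k h = Cmp M m k f g \<and> Cod M k h = Idn M m (Dom M m f) \<and>
           Dom M k h' = Cmp M m k g f \<and> Cod M k h' = Idn M m (Cod M m f))})"

primrec eq_stage :: "'a omega_magma \<Rightarrow> nat \<Rightarrow> nat \<Rightarrow> 'a set" where
  "eq_stage M 0 = composites M (el M)"
| "eq_stage M (Suc n) =
     composites M (\<lambda>k. eq_stage M n k \<union> invertible_up_to M (eq_stage M n) k)"

definition Eq :: "'a omega_magma \<Rightarrow> nat \<Rightarrow> 'a set" where
  "Eq M k = (\<Union>n. eq_stage M n k)"


section \<open>Weak equivalences\<close>

definition tame :: "('a, 'b, 'c) weak_omega_cat \<Rightarrow> ('d, 'e, 'f) weak_omega_cat \<Rightarrow>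
    ('a, 'b, 'c, 'd, 'e, 'f) pseudofunctor \<Rightarrow> bool" where
  "tame X Y F \<longleftrightarrow> (\<forall>k. F1 F k ` Eq (M1 X) k \<subseteq> Eq (M1 Y) k)"

definition eq_rel :: "'a omega_magma \<Rightarrow> ('a \<times> 'a) set" where
  "eq_rel M = {(a, b). a \<in> Cells M 0 \<and> b \<in> Cells M 0 \<and>
     (\<exists>f \<in> Eq M 1. Dom M 0 f = a \<and> Cod M 0 f = b)}"

definition Pi0 :: "'a omega_magma \<Rightarrow> 'a set set" where
  "Pi0 M = Cells M 0 // eq_rel M"

text \<open>The map induced on classes by a map of \<open>0\<close>-cells: the class of \<open>a\<close> goes to the class of the
  image of \<open>a\<close>, written without choosing a representative.\<close>

definition Pi0_map :: "'b omega_magma \<Rightarrow> ('a \<Rightarrow> 'b) \<Rightarrow> 'a set \<Rightarrow> 'b set" where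
  "Pi0_map N \<phi> C = eq_rel N `` (\<phi> ` C)"

definition weak_equivalence :: "('a, 'b, 'c) weak_omega_cat \<Rightarrow> ('d, 'e, 'f) weak_omega_cat \<Rightarrow>
    ('a, 'b, 'c, 'd, 'e, 'f) pseudofunctor \<Rightarrow> bool" where
  "weak_equivalence X Y F \<longleftrightarrow> omega_pseudofunctor X Y F \<and> tame X Y F \<and>
     bij_betw (Pi0_map (M1 Y) (F1 F 0)) (Pi0 (M1 X)) (Pi0 (M1 Y)) \<and>
     (\<forall>m. \<forall>a \<in> Cells (M1 X) m. \<forall>b \<in> Cells (M1 X) m.
        bij_betw (Pi0_map (hom_magma (M1 Y) m (F1 F m a) (F1 F m b)) (F1 F (Suc m)))
          (Pi0 (hom_magma (M1 X) m a b))
          (Pi0 (hom_magma (M1 Y) m (F1 F m a) (F1 F m b))))"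


section \<open>Categories\<close>

record ('o, 'm) cat =
  Obj :: "'o set"
  Mor :: "'m set"
  Source :: "'m \<Rightarrow> 'o"
  Target :: "'m \<Rightarrow> 'o"
  Ident :: "'o \<Rightarrow> 'm"
  Comp :: "'m \<Rightarrow> 'm \<Rightarrow> 'm"

definition in_hom :: "('o, 'm) cat \<Rightarrow> 'm \<Rightarrow> 'o \<Rightarrow> 'o \<Rightarrow> bool" where
  "in_hom C f x y \<longleftrightarrow> f \<in> Mor C \<and> Source C f = x \<and> Target C f = y"

locale category =
  fixes C :: "('o, 'm) cat" (structure)
  assumes Source_Obj: "f \<in> Mor C \<Longrightarrow> Source C f \<in> Obj C"
    and Target_Obj: "f \<in> Mor C \<Longrightarrow> Target C f \<in> Obj C"
    and Ident_hom: "x \<in> Obj C \<Longrightarrow> in_hom C (Ident C x) x x"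
    and Comp_hom: "in_hom C f x y \<Longrightarrow> in_hom C g y z \<Longrightarrow> in_hom C (Comp C f g) x z"
    and Comp_Ident_left: "in_hom C f x y \<Longrightarrow> Comp C (Ident C x) f = f"
    and Comp_Ident_right: "in_hom C f x y \<Longrightarrow> Comp C f (Ident C y) = f"
    and Comp_assoc: "in_hom C f w x \<Longrightarrow> in_hom C g x y \<Longrightarrow> in_hom C h y z \<Longrightarrow>
      Comp C (Comp C f g) h = Comp C f (Comp C g h)"

definition iso :: "('o, 'm) cat \<Rightarrow> 'm \<Rightarrow> 'o \<Rightarrow> 'o \<Rightarrow> bool" where
  "iso C f x y \<longleftrightarrow> in_hom C f x y \<and>
     (\<exists>g. in_hom C g y x \<and> Comp C f g = Ident C x \<and> Comp C g f = Ident C y)"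

locale cat_functor = C: category C + D: category D
  for C :: "('o, 'm) cat" and D :: "('p, 'n) cat" and Fo :: "'o \<Rightarrow> 'p" and Fm :: "'m \<Rightarrow> 'n" +
  assumes Fo_Obj: "x \<in> Obj C \<Longrightarrow> Fo x \<in> Obj D"
    and Fm_hom: "in_hom C f x y \<Longrightarrow> in_hom D (Fm f) (Fo x) (Fo y)"
    and Fm_Ident: "x \<in> Obj C \<Longrightarrow> Fm (Ident C x) = Ident D (Fo x)"
    and Fm_Comp: "in_hom C f x y \<Longrightarrow> in_hom C g y z \<Longrightarrow>
      Fm (Comp C f g) = Comp D (Fm f) (Fm g)"

definition natural_iso :: "('o, 'm) cat \<Rightarrow> ('p, 'n) cat \<Rightarrow> ('o \<Rightarrow> 'p) \<Rightarrow> ('m \<Rightarrow> 'n) \<Rightarrow>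
    ('o \<Rightarrow> 'p) \<Rightarrow> ('m \<Rightarrow> 'n) \<Rightarrow> ('o \<Rightarrow> 'n) \<Rightarrow> bool" where
  "natural_iso C D Fo Fm Go Gm \<eta> \<longleftrightarrow>
     (\<forall>x \<in> Obj C. iso D (\<eta> x) (Fo x) (Go x)) \<and>
     (\<forall>f x y. in_hom C f x y \<longrightarrow> Comp D (\<eta> x) (Gm f) = Comp D (Fm f) (\<eta> y))"

definition equivalence_of_categories ::
  "('o, 'm) cat \<Rightarrow> ('p, 'n) cat \<Rightarrow> ('o \<Rightarrow> 'p) \<Rightarrow> ('m \<Rightarrow> 'n) \<Rightarrow> bool" where
  "equivalence_of_categories C D Fo Fm \<longleftrightarrow> cat_functor C D Fo Fm \<and>
     (\<exists>Go Gm \<eta> \<epsilon>. cat_functor D C Go Gm \<and>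
        natural_iso C C id id (Go \<circ> Fo) (Gm \<circ> Fm) \<eta> \<and>
        natural_iso D D (Fo \<circ> Go) (Fm \<circ> Gm) id id \<epsilon>)"


section \<open>Bicategories\<close>

text \<open>Both compositions are written in diagrammatic order.\<close>

record ('o, 'm, 't) bicat =
  Obs :: "'o set"
  Ones :: "'m set"
  Twos :: "'t set"
  Src1 :: "'m \<Rightarrow> 'o"
  Tgt1 :: "'m \<Rightarrow> 'o"
  Src2 :: "'t \<Rightarrow> 'm"
  Tgt2 :: "'t \<Rightarrow> 'm"
  Id1 :: "'o \<Rightarrow> 'm"
  Id2 :: "'m \<Rightarrow> 't"
  VComp :: "'t \<Rightarrow> 't \<Rightarrow> 't"
  HComp1 :: "'m \<Rightarrow> 'm \<Rightarrow> 'm"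
  HComp2 :: "'t \<Rightarrow> 't \<Rightarrow> 't"
  Assoc :: "'m \<Rightarrow> 'm \<Rightarrow> 'm \<Rightarrow> 't"
  LUnit :: "'m \<Rightarrow> 't"
  RUnit :: "'m \<Rightarrow> 't"

definition hom1 :: "('o, 'm, 't) bicat \<Rightarrow> 'm \<Rightarrow> 'o \<Rightarrow> 'o \<Rightarrow> bool" where
  "hom1 B f a b \<longleftrightarrow> f \<in> Ones B \<and> Src1 B f = a \<and> Tgt1 B f = b"

definition hom2 :: "('o, 'm, 't) bicat \<Rightarrow> 't \<Rightarrow> 'm \<Rightarrow> 'm \<Rightarrow> bool" where
  "hom2 B \<alpha> f g \<longleftrightarrow> \<alpha> \<in> Twos B \<and> Src2 B \<alpha> = f \<and> Tgt2 B \<alpha> = g"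

definition hom_cat :: "('o, 'm, 't) bicat \<Rightarrow> 'o \<Rightarrow> 'o \<Rightarrow> ('m, 't) cat" where
  "hom_cat B a b =
     \<lparr>Obj = {f. hom1 B f a b},
      Mor = {\<alpha> \<in> Twos B. hom1 B (Src2 B \<alpha>) a b \<and> hom1 B (Tgt2 B \<alpha>) a b},
      Source = Src2 B, Target = Tgt2 B, Ident = Id2 B, Comp = VComp B\<rparr>"

definition iso2 :: "('o, 'm, 't) bicat \<Rightarrow> 't \<Rightarrow> 'm \<Rightarrow> 'm \<Rightarrow> bool" where
  "iso2 B \<alpha> f g \<longleftrightarrow> iso (hom_cat B (Src1 B f) (Tgt1 B f)) \<alpha> f g"

text \<open>The pentagon is named separately: for the bicategory of a 2-skeletal weak omega category
  the remaining axioms of \<open>bicategory\<close> follow from the definitions, but the pentagon does not,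
  because \<open>\<rho>\<close> is not required to be compatible with composition.\<close>

definition pentagon_law :: "('o, 'm, 't) bicat \<Rightarrow> bool" where
  "pentagon_law B \<longleftrightarrow>
     (\<forall>f g h k a b c d e. hom1 B f a b \<and> hom1 B g b c \<and> hom1 B h c d \<and> hom1 B k d e \<longrightarrow>
        VComp B (Assoc B f g (HComp1 B h k)) (Assoc B (HComp1 B f g) h k) =
        VComp B (VComp B (HComp2 B (Id2 B f) (Assoc B g h k)) (Assoc B f (HComp1 B g h) k))
          (HComp2 B (Assoc B f g h) (Id2 B k)))"

locale bicategory =
  fixes B :: "('o, 'm, 't) bicat" (structure)
  assumes Src1_Obs: "f \<in> Ones B \<Longrightarrow> Src1 B f \<in> Obs B"
    and Tgt1_Obs: "f \<in> Ones B \<Longrightarrow> Tgt1 B f \<in> Obs B"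
    and Src2_Ones: "\<alpha> \<in> Twos B \<Longrightarrow> Src2 B \<alpha> \<in> Ones B"
    and Tgt2_Ones: "\<alpha> \<in> Twos B \<Longrightarrow> Tgt2 B \<alpha> \<in> Ones B"
    and Src1_Src2: "\<alpha> \<in> Twos B \<Longrightarrow> Src1 B (Src2 B \<alpha>) = Src1 B (Tgt2 B \<alpha>)"
    and Tgt1_Src2: "\<alpha> \<in> Twos B \<Longrightarrow> Tgt1 B (Src2 B \<alpha>) = Tgt1 B (Tgt2 B \<alpha>)"
    and hom_category: "a \<in> Obs B \<Longrightarrow> b \<in> Obs B \<Longrightarrow> category (hom_cat B a b)"
    and Id1_hom: "a \<in> Obs B \<Longrightarrow> hom1 B (Id1 B a) a a"
    and HComp1_hom: "hom1 B f a b \<Longrightarrow> hom1 B g b c \<Longrightarrow> hom1 B (HComp1 B f g) a c"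
    and HComp2_hom: "hom2 B \<alpha> f f' \<Longrightarrow> hom2 B \<beta> g g' \<Longrightarrow> Tgt1 B f = Src1 B g \<Longrightarrow>
      hom2 B (HComp2 B \<alpha> \<beta>) (HComp1 B f g) (HComp1 B f' g')"
    and HComp2_Id2: "hom1 B f a b \<Longrightarrow> hom1 B g b c \<Longrightarrow>
      HComp2 B (Id2 B f) (Id2 B g) = Id2 B (HComp1 B f g)"
    and HComp2_VComp: "hom2 B \<alpha> f f' \<Longrightarrow> hom2 B \<alpha>' f' f'' \<Longrightarrow> hom2 B \<beta> g g' \<Longrightarrow> hom2 B \<beta>' g' g'' \<Longrightarrow>
      Tgt1 B f = Src1 B g \<Longrightarrow>
      HComp2 B (VComp B \<alpha> \<alpha>') (VComp B \<beta> \<beta>') = VComp B (HComp2 B \<alpha> \<beta>) (HComp2 B \<alpha>' \<beta>')"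
    and Assoc_iso: "hom1 B f a b \<Longrightarrow> hom1 B g b c \<Longrightarrow> hom1 B h c d \<Longrightarrow>
      iso2 B (Assoc B f g h) (HComp1 B f (HComp1 B g h)) (HComp1 B (HComp1 B f g) h)"
    and Assoc_natural: "hom2 B \<alpha> f f' \<Longrightarrow> hom2 B \<beta> g g' \<Longrightarrow> hom2 B \<gamma> h h' \<Longrightarrow>
      Tgt1 B f = Src1 B g \<Longrightarrow> Tgt1 B g = Src1 B h \<Longrightarrow>
      VComp B (HComp2 B \<alpha> (HComp2 B \<beta> \<gamma>)) (Assoc B f' g' h') =
      VComp B (Assoc B f g h) (HComp2 B (HComp2 B \<alpha> \<beta>) \<gamma>)"
    and LUnit_iso: "hom1 B f a b \<Longrightarrow> iso2 B (LUnit B f) (HComp1 B (Id1 B a) f) f"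
    and LUnit_natural: "hom2 B \<alpha> f f' \<Longrightarrow> Src1 B f = a \<Longrightarrow>
      VComp B (HComp2 B (Id2 B (Id1 B a)) \<alpha>) (LUnit B f') = VComp B (LUnit B f) \<alpha>"
    and RUnit_iso: "hom1 B f a b \<Longrightarrow> iso2 B (RUnit B f) (HComp1 B f (Id1 B b)) f"
    and RUnit_natural: "hom2 B \<alpha> f f' \<Longrightarrow> Tgt1 B f = b \<Longrightarrow>
      VComp B (HComp2 B \<alpha> (Id2 B (Id1 B b))) (RUnit B f') = VComp B (RUnit B f) \<alpha>"
    and triangle: "hom1 B f a b \<Longrightarrow> hom1 B g b c \<Longrightarrow>
      VComp B (Assoc B f (Id1 B b) g) (HComp2 B (RUnit B f) (Id2 B g)) =
      HComp2 B (Id2 B f) (LUnit B g)"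
    and pentagon: "pentagon_law B"

text \<open>\<open>CompC f g : F f * F g \<Rightarrow> F (f * g)\<close> and \<open>UnitC a : id (F a) \<Rightarrow> F (id a)\<close> are the comparison
  cells of a homomorphism.\<close>

record ('o, 'm, 't, 'p, 'n, 'u) bihom =
  Map0 :: "'o \<Rightarrow> 'p"
  Map1 :: "'m \<Rightarrow> 'n"
  Map2 :: "'t \<Rightarrow> 'u"
  CompC :: "'m \<Rightarrow> 'm \<Rightarrow> 'u"
  UnitC :: "'o \<Rightarrow> 'u"

text \<open>The coherence conditions on the comparison cells: naturality, compatibility with the
  associators, and compatibility with the left and right unit isomorphisms.\<close>

definition comparison_coherent :: "('o, 'm, 't) bicat \<Rightarrow> ('p, 'n, 'u) bicat \<Rightarrow>
    ('o, 'm, 't, 'p, 'n, 'u) bihom \<Rightarrow> bool" where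
  "comparison_coherent B C H \<longleftrightarrow>
     (\<forall>\<alpha> \<beta> f f' g g'. hom2 B \<alpha> f f' \<and> hom2 B \<beta> g g' \<and> Tgt1 B f = Src1 B g \<longrightarrow>
        VComp C (HComp2 C (Map2 H \<alpha>) (Map2 H \<beta>)) (CompC H f' g') =
        VComp C (CompC H f g) (Map2 H (HComp2 B \<alpha> \<beta>))) \<and>
     (\<forall>f g h a b c d. hom1 B f a b \<and> hom1 B g b c \<and> hom1 B h c d \<longrightarrow>
        VComp C (VComp C (HComp2 C (Id2 C (Map1 H f)) (CompC H g h)) (CompC H f (HComp1 B g h)))
          (Map2 H (Assoc B f g h)) =
        VComp C (VComp C (Assoc C (Map1 H f) (Map1 H g) (Map1 H h))
            (HComp2 C (CompC H f g) (Id2 C (Map1 H h))))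
          (CompC H (HComp1 B f g) h)) \<and>
     (\<forall>f a b. hom1 B f a b \<longrightarrow>
        VComp C (VComp C (HComp2 C (UnitC H a) (Id2 C (Map1 H f))) (CompC H (Id1 B a) f))
          (Map2 H (LUnit B f)) =
        LUnit C (Map1 H f)) \<and>
     (\<forall>f a b. hom1 B f a b \<longrightarrow>
        VComp C (VComp C (HComp2 C (Id2 C (Map1 H f)) (UnitC H b)) (CompC H f (Id1 B b)))
          (Map2 H (RUnit B f)) =
        RUnit C (Map1 H f))"

locale homomorphism = B: bicategory B + C: bicategory C
  for B :: "('o, 'm, 't) bicat" and C :: "('p, 'n, 'u) bicat"
    and H :: "('o, 'm, 't, 'p, 'n, 'u) bihom" +
  assumes Map0_Obs: "a \<in> Obs B \<Longrightarrow> Map0 H a \<in> Obs C"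
    and Map_functor: "a \<in> Obs B \<Longrightarrow> b \<in> Obs B \<Longrightarrow>
      cat_functor (hom_cat B a b) (hom_cat C (Map0 H a) (Map0 H b)) (Map1 H) (Map2 H)"
    and CompC_iso: "hom1 B f a b \<Longrightarrow> hom1 B g b c \<Longrightarrow>
      iso2 C (CompC H f g) (HComp1 C (Map1 H f) (Map1 H g)) (Map1 H (HComp1 B f g))"
    and UnitC_iso: "a \<in> Obs B \<Longrightarrow> iso2 C (UnitC H a) (Id1 C (Map0 H a)) (Map1 H (Id1 B a))"
    and coherent: "comparison_coherent B C H"

definition equivalence_1cell :: "('o, 'm, 't) bicat \<Rightarrow> 'm \<Rightarrow> 'o \<Rightarrow> 'o \<Rightarrow> bool" where
  "equivalence_1cell B f a b \<longleftrightarrow> hom1 B f a b \<and>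
     (\<exists>g \<eta> \<epsilon>. hom1 B g b a \<and> iso2 B \<eta> (HComp1 B f g) (Id1 B a) \<and>
        iso2 B \<epsilon> (HComp1 B g f) (Id1 B b))"

definition surjective_up_to_equivalence :: "('o, 'm, 't) bicat \<Rightarrow> ('p, 'n, 'u) bicat \<Rightarrow>
    ('o, 'm, 't, 'p, 'n, 'u) bihom \<Rightarrow> bool" where
  "surjective_up_to_equivalence B C H \<longleftrightarrow>
     (\<forall>b \<in> Obs C. \<exists>a \<in> Obs B. \<exists>f. equivalence_1cell C f (Map0 H a) b)"

definition equivalence_on_homs :: "('o, 'm, 't) bicat \<Rightarrow> ('p, 'n, 'u) bicat \<Rightarrow>
    ('o, 'm, 't, 'p, 'n, 'u) bihom \<Rightarrow> bool" where
  "equivalence_on_homs B C H \<longleftrightarrow>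
     (\<forall>a \<in> Obs B. \<forall>b \<in> Obs B. equivalence_of_categories
        (hom_cat B a b) (hom_cat C (Map0 H a) (Map0 H b)) (Map1 H) (Map2 H))"

definition biequivalence :: "('o, 'm, 't) bicat \<Rightarrow> ('p, 'n, 'u) bicat \<Rightarrow>
    ('o, 'm, 't, 'p, 'n, 'u) bihom \<Rightarrow> bool" where
  "biequivalence B C H \<longleftrightarrow> homomorphism B C H \<and>
     surjective_up_to_equivalence B C H \<and> equivalence_on_homs B C H"


section \<open>The bicategory of a 2-skeletal weak omega category\<close>

definition bicat_of :: "('a, 'b, 'c) weak_omega_cat \<Rightarrow> ('a, 'a, 'a) bicat" where
  "bicat_of X =
     (let A = M1 X; P = M2 X; r = rho X 1; b = (\<lambda>s t. lam X 2 (bridge_cell (bridge X) 1 s t)) in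
      \<lparr>Obs = Cells A 0, Ones = Cells A 1, Twos = Cells A 2,
       Src1 = Dom A 0, Tgt1 = Cod A 0, Src2 = Dom A 1, Tgt2 = Cod A 1,
       Id1 = Idn A 0, Id2 = Idn A 1,
       VComp = Cmp A 1 2, HComp1 = Cmp A 0 1, HComp2 = Cmp A 0 2,
       Assoc = (\<lambda>f g h. b (Cmp P 0 1 (r f) (Cmp P 0 1 (r g) (r h)))
                          (Cmp P 0 1 (Cmp P 0 1 (r f) (r g)) (r h))),
       LUnit = (\<lambda>f. b (Cmp P 0 1 (Idn P 0 (rho X 0 (Dom A 0 f))) (r f)) (r f)),
       RUnit = (\<lambda>f. b (Cmp P 0 1 (r f) (Idn P 0 (rho X 0 (Cod A 0 f)))) (r f))\<rparr>)"

definition bihom_of :: "('a, 'b, 'c) weak_omega_cat \<Rightarrow> ('d, 'e, 'f) weak_omega_cat \<Rightarrow>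
    ('a, 'b, 'c, 'd, 'e, 'f) pseudofunctor \<Rightarrow> ('a, 'a, 'a, 'd, 'd, 'd) bihom" where
  "bihom_of X Y F =
     (let b = (\<lambda>s t. lam Y 2 (bridge_cell (bridge Y) 1 s t)) in
      \<lparr>Map0 = F1 F 0, Map1 = F1 F 1, Map2 = F1 F 2,
       CompC = (\<lambda>f g. b (Cmp (M2 Y) 0 1 (F2 F 1 (rho X 1 f)) (F2 F 1 (rho X 1 g)))
                        (F2 F 1 (Cmp (M2 X) 0 1 (rho X 1 f) (rho X 1 g)))),
       UnitC = (\<lambda>a. b (Idn (M2 Y) 0 (F2 F 0 (rho X 0 a)))
                      (F2 F 1 (Idn (M2 X) 0 (rho X 0 a))))\<rparr>)"

end

theory Submission
  imports Defs
begin

text \<open>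
  A strict omega category \<open>M3\<close> sits behind a weak one, and this settles most equations between
  2-cells. Two parallel 2-cells \<open>s\<close>, \<open>t\<close> of \<open>M2\<close> with the same image under \<open>\<kappa>\<close> are joined by a
  bridge 3-cell; \<open>\<lambda>\<close> sends it to a 3-cell of \<open>M1\<close>, which is an identity because \<open>M1\<close> is
  2-skeletal, so \<open>\<lambda> s = \<lambda> t\<close> (\<open>lam_eq_if_kap_eq\<close>). An equation between 2-cells of \<open>M1\<close> therefore
  holds as soon as both sides are images under \<open>\<lambda>\<close> of parallel diagrams in \<open>M2\<close> that agree in
  \<open>M3\<close>. In \<open>M3\<close> composition is strict and bridge cells are identities, so such agreement is
  a computation in a strict 2-category. This gives the category and bicategory axioms, the
  invertibility of every image of a bridge 2-cell (\<open>iso2_lam_bridge\<close>), and, since a pseudo-functor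
  preserves identities and top-dimensional composition up to \<open>\<kappa>\<close>, functoriality on hom-categories.
  The pentagon and the compatibility of the comparison cells with associators escape this argument:
  they involve \<open>\<rho> (f * g)\<close>, whose image in \<open>M3\<close> is unrelated to that of \<open>\<rho> f * \<rho> g\<close>. So does
  naturality of the comparison cells, since nothing relates a pseudo-functor to horizontal
  composition of 2-cells. The pentagon laws and \<open>comparison_coherent\<close> therefore enter as premises.

  The second ingredient identifies internal equivalences. In the free clique on two objects the
  bridge cells \<open>s \<rightarrow> t\<close> and \<open>t \<rightarrow> s\<close> compose to something bridged with the identity; under a
  morphism into a magma whose cells one dimension higher have equal domain and codomain they become
  inverse to each other (\<open>clique_bridge_inverse\<close>). Hence internal equivalences of dimension 2, and
  those of dimension 1 in a hom magma, are invertible 2-cells, and from this internal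
  equivalences of dimension 1 are equivalence 1-cells of the bicategory (\<open>equivalence_Eq_1\<close>); both
  properties survive composition and the inductive stages of the definition.

  Given this, surjectivity of \<open>\<Pi> F\<close> is surjectivity on objects up to equivalence, surjectivity of
  \<open>\<Pi> F(a,b)\<close> on objects \<open>a\<close>, \<open>b\<close> is essential surjectivity on hom-categories, and bijectivity of
  \<open>\<Pi> F(f,g)\<close> on 1-cells \<open>f\<close>, \<open>g\<close> is full faithfulness, because 2-cells of a 2-skeletal magma are
  internally equivalent only if they are equal (\<open>eq_rel_hom_2\<close>).
\<close>

section \<open>Composition in dimensions one and two\<close>

text \<open>
  The three compositions that occur in a bicategory are the top-dimensional ones, along
  \<open>i\<close>-cells in dimension \<open>i + 1\<close>, and the horizontal composition of 2-cells. Their axioms are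
  put in a form free of iterated boundaries, in which all side conditions can be decided by
  computing domains and codomains. Dimensions are written as successors because the
  axioms of omega magmas are.
\<close>

context globular_set
begin

lemma composable_top:
  "composable X i (Suc i) a b \<longleftrightarrow>
    a \<in> Cells X (Suc i) \<and> b \<in> Cells X (Suc i) \<and> Cod X i a = Dom X i b"
proof -
  have "dom_it X i i c = c" "cod_it X i i c = c" for c
    by (cases i; simp)+
  then show ?thesis by (simp add: composable_def)
qed

text \<open>
  By globularity the 0-dimensional codomain of a 2-cell may be taken through its domain; always
  going through the domain gives every 0-dimensional boundary a unique normal form.
\<close>

lemma composable_02:
  "composable X 0 (Suc (Suc 0)) \<alpha> \<beta> \<longleftrightarrow>
    \<alpha> \<in> Cells X (Suc (Suc 0)) \<and> \<beta> \<in> Cells X (Suc (Suc 0)) \<and>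
    Cod X 0 (Dom X (Suc 0) \<alpha>) = Dom X 0 (Dom X (Suc 0) \<beta>)"
  using Cod_Dom[of \<alpha> 0] by (auto simp: composable_def)

lemmas composable_low = composable_top composable_02

end

context omega_magma
begin

lemma Cmp_top:
  assumes "a \<in> Cells X (Suc i)" "b \<in> Cells X (Suc i)" "Cod X i a = Dom X i b"
  shows "Cmp X i (Suc i) a b \<in> Cells X (Suc i)"
    and "Dom X i (Cmp X i (Suc i) a b) = Dom X i a"
    and "Cod X i (Cmp X i (Suc i) a b) = Cod X i b"
  using assms Cmp_cells[of i "Suc i" a b] Dom_Cmp_top[of i a b] Cod_Cmp_top[of i a b]
  by (simp_all add: composable_top)

lemma Cmp_02:
  assumes "\<alpha> \<in> Cells X (Suc (Suc 0))" "\<beta> \<in> Cells X (Suc (Suc 0))"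
    and "Cod X 0 (Dom X (Suc 0) \<alpha>) = Dom X 0 (Dom X (Suc 0) \<beta>)"
  shows "Cmp X 0 (Suc (Suc 0)) \<alpha> \<beta> \<in> Cells X (Suc (Suc 0))"
    and "Dom X (Suc 0) (Cmp X 0 (Suc (Suc 0)) \<alpha> \<beta>) =
      Cmp X 0 (Suc 0) (Dom X (Suc 0) \<alpha>) (Dom X (Suc 0) \<beta>)"
    and "Cod X (Suc 0) (Cmp X 0 (Suc (Suc 0)) \<alpha> \<beta>) =
      Cmp X 0 (Suc 0) (Cod X (Suc 0) \<alpha>) (Cod X (Suc 0) \<beta>)"
  using assms Cmp_cells[of 0 "Suc (Suc 0)" \<alpha> \<beta>] Dom_Cmp_low[of 0 "Suc 0" \<alpha> \<beta>]
    Cod_Cmp_low[of 0 "Suc 0" \<alpha> \<beta>]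
  by (simp_all add: composable_low)

lemmas typing = Dom_cells Cod_cells Idn_cells Dom_Idn Cod_Idn Cmp_top Cmp_02

end

context strict_omega_category
begin

lemma strict_assoc:
  "\<lbrakk>a \<in> Cells X (Suc i); b \<in> Cells X (Suc i); c \<in> Cells X (Suc i); Cod X i a = Dom X i b;
    Cod X i b = Dom X i c\<rbrakk> \<Longrightarrow>
    Cmp X i (Suc i) (Cmp X i (Suc i) a b) c = Cmp X i (Suc i) a (Cmp X i (Suc i) b c)"
  "\<lbrakk>\<alpha> \<in> Cells X (Suc (Suc 0)); \<beta> \<in> Cells X (Suc (Suc 0)); \<gamma> \<in> Cells X (Suc (Suc 0));
    Cod X 0 (Dom X (Suc 0) \<alpha>) = Dom X 0 (Dom X (Suc 0) \<beta>);
    Cod X 0 (Dom X (Suc 0) \<beta>) = Dom X 0 (Dom X (Suc 0) \<gamma>)\<rbrakk> \<Longrightarrow>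
    Cmp X 0 (Suc (Suc 0)) (Cmp X 0 (Suc (Suc 0)) \<alpha> \<beta>) \<gamma> =
    Cmp X 0 (Suc (Suc 0)) \<alpha> (Cmp X 0 (Suc (Suc 0)) \<beta> \<gamma>)"
  by (rule Cmp_assoc; simp add: composable_low)+

lemma strict_interchange:
  assumes "\<alpha> \<in> Cells X (Suc (Suc 0))" "\<beta> \<in> Cells X (Suc (Suc 0))"
    "\<gamma> \<in> Cells X (Suc (Suc 0))" "\<delta> \<in> Cells X (Suc (Suc 0))"
    "Cod X (Suc 0) \<alpha> = Dom X (Suc 0) \<beta>" "Cod X (Suc 0) \<gamma> = Dom X (Suc 0) \<delta>"
    "Cod X 0 (Dom X (Suc 0) \<alpha>) = Dom X 0 (Dom X (Suc 0) \<gamma>)"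
  shows "Cmp X 0 (Suc (Suc 0)) (Cmp X (Suc 0) (Suc (Suc 0)) \<alpha> \<beta>) (Cmp X (Suc 0) (Suc (Suc 0)) \<gamma> \<delta>) =
    Cmp X (Suc 0) (Suc (Suc 0)) (Cmp X 0 (Suc (Suc 0)) \<alpha> \<gamma>) (Cmp X 0 (Suc (Suc 0)) \<beta> \<delta>)"
proof (rule Cmp_interchange)
  have "Cod X 0 (Dom X (Suc 0) \<beta>) = Dom X 0 (Dom X (Suc 0) \<delta>)"
    using assms Cod_Dom[of \<alpha> 0] Dom_Dom[of \<gamma> 0] by simp
  then show "composable X 0 (Suc (Suc 0)) \<beta> \<delta>" using assms by (simp add: composable_low)
qed (use assms in \<open>simp_all add: composable_low\<close>)

lemma strict_units:
  "\<lbrakk>a \<in> Cells X (Suc i); Dom X i a = u\<rbrakk> \<Longrightarrow> Cmp X i (Suc i) (Idn X i u) a = a"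
  "\<lbrakk>a \<in> Cells X (Suc i); Cod X i a = u\<rbrakk> \<Longrightarrow> Cmp X i (Suc i) a (Idn X i u) = a"
  "\<lbrakk>\<alpha> \<in> Cells X (Suc (Suc 0)); Dom X 0 (Dom X (Suc 0) \<alpha>) = x\<rbrakk> \<Longrightarrow>
    Cmp X 0 (Suc (Suc 0)) (Idn X (Suc 0) (Idn X 0 x)) \<alpha> = \<alpha>"
  "\<lbrakk>\<alpha> \<in> Cells X (Suc (Suc 0)); Cod X 0 (Dom X (Suc 0) \<alpha>) = y\<rbrakk> \<Longrightarrow>
    Cmp X 0 (Suc (Suc 0)) \<alpha> (Idn X (Suc 0) (Idn X 0 y)) = \<alpha>"
proof -
  have "id_it X i i c = c" "dom_it X i i c = c" "cod_it X i i c = c" for i c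
    by (cases i; simp)+
  then show
    "\<lbrakk>a \<in> Cells X (Suc i); Dom X i a = u\<rbrakk> \<Longrightarrow> Cmp X i (Suc i) (Idn X i u) a = a"
    "\<lbrakk>a \<in> Cells X (Suc i); Cod X i a = u\<rbrakk> \<Longrightarrow> Cmp X i (Suc i) a (Idn X i u) = a"
    "\<lbrakk>\<alpha> \<in> Cells X (Suc (Suc 0)); Dom X 0 (Dom X (Suc 0) \<alpha>) = x\<rbrakk> \<Longrightarrow>
      Cmp X 0 (Suc (Suc 0)) (Idn X (Suc 0) (Idn X 0 x)) \<alpha> = \<alpha>"
    "\<lbrakk>\<alpha> \<in> Cells X (Suc (Suc 0)); Cod X 0 (Dom X (Suc 0) \<alpha>) = y\<rbrakk> \<Longrightarrow>
      Cmp X 0 (Suc (Suc 0)) \<alpha> (Idn X (Suc 0) (Idn X 0 y)) = \<alpha>"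
    using Cmp_id_left[of i "Suc i" a] Cmp_id_right[of i "Suc i" a]
      Cmp_id_left[of 0 "Suc (Suc 0)" \<alpha>] Cmp_id_right[of 0 "Suc (Suc 0)" \<alpha>] Cod_Dom[of \<alpha> 0]
    by auto
qed

lemma strict_Idn:
  "\<lbrakk>f \<in> Cells X (Suc 0); g \<in> Cells X (Suc 0); Cod X 0 f = Dom X 0 g\<rbrakk> \<Longrightarrow>
    Cmp X 0 (Suc (Suc 0)) (Idn X (Suc 0) f) (Idn X (Suc 0) g) = Idn X (Suc 0) (Cmp X 0 (Suc 0) f g)"
  using Cmp_Idn[of 0 "Suc 0" f g] by (simp add: composable_low)

lemmas strict_laws = strict_assoc strict_interchange strict_units strict_Idn

end

lemma globular_morphismD:
  assumes "globular_morphism M N G"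
  shows "a \<in> Cells M i \<Longrightarrow> G i a \<in> Cells N i"
    and "a \<in> Cells M (Suc i) \<Longrightarrow> Dom N i (G (Suc i) a) = G i (Dom M i a)"
    and "a \<in> Cells M (Suc i) \<Longrightarrow> Cod N i (G (Suc i) a) = G i (Cod M i a)"
  using assms by (simp_all add: globular_morphism_def)

lemma graph_morphismD:
  assumes "graph_morphism M N G"
  shows "globular_morphism M N G"
    and "a \<in> Cells M i \<Longrightarrow> G (Suc i) (Idn M i a) = Idn N i (G i a)"
  using assms by (simp_all add: graph_morphism_def)

lemma magma_morphismD:
  assumes "magma_morphism M N G"
  shows "graph_morphism M N G"
    and "composable M i j a b \<Longrightarrow> G j (Cmp M i j a b) = Cmp N i j (G j a) (G j b)"
  using assms by (simp_all add: magma_morphism_def)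

section \<open>Coherence in 2-skeletal weak omega categories\<close>

sublocale weak_omega_category \<subseteq> A: omega_magma "M1 X" by (rule M1)
sublocale weak_omega_category \<subseteq> P: omega_magma "M2 X" by (rule M2)
sublocale weak_omega_category \<subseteq> C: strict_omega_category "M3 X" by (rule M3)

context weak_omega_category
begin

lemma kap_magma: "magma_morphism (M2 X) (M3 X) (kap X)"
  using kap by (simp add: penon_morphism_def bridge_morphism_def)

lemmas lam_graph = magma_morphismD(1)[OF lam]
lemmas kap_graph = magma_morphismD(1)[OF kap_magma]

lemmas map_simps =
  globular_morphismD[OF graph_morphismD(1)[OF lam_graph]] graph_morphismD(2)[OF lam_graph]
  globular_morphismD[OF graph_morphismD(1)[OF rho]] graph_morphismD(2)[OF rho] lam_rho
  globular_morphismD[OF graph_morphismD(1)[OF kap_graph]] graph_morphismD(2)[OF kap_graph]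

lemmas lam_kap_Cmp = magma_morphismD(2)[OF lam] magma_morphismD(2)[OF kap_magma]

end

definition inverse_2cells :: "('a, 'm) omega_magma_scheme \<Rightarrow> 'a \<Rightarrow> 'a \<Rightarrow> bool" where
  "inverse_2cells M \<alpha> \<beta> \<longleftrightarrow> \<alpha> \<in> Cells M (Suc (Suc 0)) \<and> \<beta> \<in> Cells M (Suc (Suc 0)) \<and>
     Dom M (Suc 0) \<beta> = Cod M (Suc 0) \<alpha> \<and> Cod M (Suc 0) \<beta> = Dom M (Suc 0) \<alpha> \<and>
     Cmp M (Suc 0) (Suc (Suc 0)) \<alpha> \<beta> = Idn M (Suc 0) (Dom M (Suc 0) \<alpha>) \<and>
     Cmp M (Suc 0) (Suc (Suc 0)) \<beta> \<alpha> = Idn M (Suc 0) (Cod M (Suc 0) \<alpha>)"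

definition invertible_2cell :: "('a, 'm) omega_magma_scheme \<Rightarrow> 'a \<Rightarrow> bool" where
  "invertible_2cell M \<alpha> \<longleftrightarrow> (\<exists>\<beta>. inverse_2cells M \<alpha> \<beta>)"

lemma bicat_of_sel:
  "Obs (bicat_of X) = Cells (M1 X) 0"
  "Ones (bicat_of X) = Cells (M1 X) (Suc 0)"
  "Twos (bicat_of X) = Cells (M1 X) (Suc (Suc 0))"
  "Src1 (bicat_of X) = Dom (M1 X) 0"
  "Tgt1 (bicat_of X) = Cod (M1 X) 0"
  "Src2 (bicat_of X) = Dom (M1 X) (Suc 0)"
  "Tgt2 (bicat_of X) = Cod (M1 X) (Suc 0)"
  "Id1 (bicat_of X) = Idn (M1 X) 0"
  "Id2 (bicat_of X) = Idn (M1 X) (Suc 0)"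
  "VComp (bicat_of X) = Cmp (M1 X) (Suc 0) (Suc (Suc 0))"
  "HComp1 (bicat_of X) = Cmp (M1 X) 0 (Suc 0)"
  "HComp2 (bicat_of X) = Cmp (M1 X) 0 (Suc (Suc 0))"
  "Assoc (bicat_of X) f g h = lam X (Suc (Suc 0)) (bridge_cell (bridge X) (Suc 0)
     (Cmp (M2 X) 0 (Suc 0) (rho X (Suc 0) f) (Cmp (M2 X) 0 (Suc 0) (rho X (Suc 0) g) (rho X (Suc 0) h)))
     (Cmp (M2 X) 0 (Suc 0) (Cmp (M2 X) 0 (Suc 0) (rho X (Suc 0) f) (rho X (Suc 0) g)) (rho X (Suc 0) h)))"
  "LUnit (bicat_of X) f = lam X (Suc (Suc 0)) (bridge_cell (bridge X) (Suc 0)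
     (Cmp (M2 X) 0 (Suc 0) (Idn (M2 X) 0 (rho X 0 (Dom (M1 X) 0 f))) (rho X (Suc 0) f)) (rho X (Suc 0) f))"
  "RUnit (bicat_of X) f = lam X (Suc (Suc 0)) (bridge_cell (bridge X) (Suc 0)
     (Cmp (M2 X) 0 (Suc 0) (rho X (Suc 0) f) (Idn (M2 X) 0 (rho X 0 (Cod (M1 X) 0 f)))) (rho X (Suc 0) f))"
  by (simp_all add: bicat_of_def Let_def numeral_2_eq_2)

lemma hom_cat_sel:
  "Obj (hom_cat B a b) = {f. hom1 B f a b}"
  "Mor (hom_cat B a b) = {\<alpha> \<in> Twos B. hom1 B (Src2 B \<alpha>) a b \<and> hom1 B (Tgt2 B \<alpha>) a b}"
  "Source (hom_cat B a b) = Src2 B" "Target (hom_cat B a b) = Tgt2 B"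
  "Ident (hom_cat B a b) = Id2 B" "Comp (hom_cat B a b) = VComp B"
  by (simp_all add: hom_cat_def)

context weak_omega_category
begin

text \<open>
  Pasting diagrams in \<open>M2\<close>: vertical composition \<open>\<bullet>\<close> of 2-cells, horizontal composition \<open>\<star>\<close> of
  1-cells and \<open>\<diamondop>\<close> of 2-cells.
\<close>

abbreviation VP (infixr "\<bullet>" 70) where "VP \<equiv> Cmp (M2 X) (Suc 0) (Suc (Suc 0))"
abbreviation HP1 (infixr "\<star>" 75) where "HP1 \<equiv> Cmp (M2 X) 0 (Suc 0)"
abbreviation HP2 (infixr "\<diamondop>" 75) where "HP2 \<equiv> Cmp (M2 X) 0 (Suc (Suc 0))"
abbreviation "\<rho>1 \<equiv> rho X (Suc 0)"
abbreviation "\<rho>2 \<equiv> rho X (Suc (Suc 0))"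
abbreviation "B \<equiv> bicat_of X"
abbreviation "br \<equiv> bridge_cell (bridge X) (Suc 0)"

lemma bridge_if_kap_eq:
  "parallel (M2 X) i s t \<Longrightarrow> kap X i s = kap X i t \<Longrightarrow> \<exists>c. (s, t, c) \<in> bridge X i"
  using kap unfolding penon_morphism_def by blast

text \<open>
  Equality under \<open>\<kappa>\<close> is what makes \<open>bridge_cell\<close> meaningful, and the bridge cell is then invisible in
  the strict category; together these two facts allow bridge cells as constituents of larger diagrams.
\<close>

lemma bridge_cell_1:
  assumes "s \<in> Cells (M2 X) (Suc 0)" "t \<in> Cells (M2 X) (Suc 0)"
    and "Dom (M2 X) 0 s = Dom (M2 X) 0 t" "Cod (M2 X) 0 s = Cod (M2 X) 0 t"
    and "kap X (Suc 0) s = kap X (Suc 0) t"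
  shows "bridge_cell (bridge X) (Suc 0) s t \<in> Cells (M2 X) (Suc (Suc 0))"
    and "Dom (M2 X) (Suc 0) (bridge_cell (bridge X) (Suc 0) s t) = s"
    and "Cod (M2 X) (Suc 0) (bridge_cell (bridge X) (Suc 0) s t) = t"
    and "kap X (Suc (Suc 0)) (bridge_cell (bridge X) (Suc 0) s t) = Idn (M3 X) (Suc 0) (kap X (Suc 0) t)"
proof -
  interpret R: bridge_relation "M2 X" "bridge X" by (rule bridge)
  obtain c where c: "(s, t, c) \<in> bridge X (Suc 0)"
    using bridge_if_kap_eq[of "Suc 0" s t] assms by (auto simp: parallel_def)
  moreover have "bridge_cell (bridge X) (Suc 0) s t = c" by (rule bridge_cell_eq[OF bridge c])
  moreover have "kap X (Suc (Suc 0)) c = Idn (M3 X) (Suc 0) (kap X (Suc 0) s)"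
    using kap c unfolding penon_morphism_def by blast
  ultimately show "bridge_cell (bridge X) (Suc 0) s t \<in> Cells (M2 X) (Suc (Suc 0))"
    "Dom (M2 X) (Suc 0) (bridge_cell (bridge X) (Suc 0) s t) = s"
    "Cod (M2 X) (Suc 0) (bridge_cell (bridge X) (Suc 0) s t) = t"
    "kap X (Suc (Suc 0)) (bridge_cell (bridge X) (Suc 0) s t) = Idn (M3 X) (Suc 0) (kap X (Suc 0) t)"
    using R.bridge_cells[OF c] R.bridge_Dom[OF c] R.bridge_Cod[OF c] assms(5) by simp_all
qed

text \<open>
  Rewriting with these rules computes boundaries in all three magmas and evaluates \<open>\<lambda>\<close> and \<open>\<kappa>\<close> on
  any pasting diagram, normalising the result in the strict category.
\<close>

lemmas calculus = A.typing P.typing C.typing map_simps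
  P.composable_low lam_kap_Cmp C.strict_laws bridge_cell_1

lemma hom1D:
  assumes "hom1 B f a b"
  shows "f \<in> Cells (M1 X) (Suc 0)" "Dom (M1 X) 0 f = a" "Cod (M1 X) 0 f = b"
    "a \<in> Cells (M1 X) 0" "b \<in> Cells (M1 X) 0"
  using assms by (auto simp: hom1_def bicat_of_sel A.typing)

lemma hom2D:
  assumes "hom2 B \<alpha> f f'"
  shows "\<alpha> \<in> Cells (M1 X) (Suc (Suc 0))" "Dom (M1 X) (Suc 0) \<alpha> = f" "Cod (M1 X) (Suc 0) \<alpha> = f'"
    "f \<in> Cells (M1 X) (Suc 0)" "f' \<in> Cells (M1 X) (Suc 0)"
    "Dom (M1 X) 0 f' = Dom (M1 X) 0 f" "Cod (M1 X) 0 f' = Cod (M1 X) 0 f"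
    "Dom (M1 X) 0 f \<in> Cells (M1 X) 0" "Cod (M1 X) 0 f \<in> Cells (M1 X) 0"
  using assms A.Dom_Dom[of \<alpha> 0] A.Cod_Dom[of \<alpha> 0]
  by (auto simp: hom2_def bicat_of_sel A.typing)

lemma in_hom_iff:
  "in_hom (hom_cat B a b) \<alpha> f g \<longleftrightarrow> hom2 B \<alpha> f g \<and> hom1 B f a b"
  (is "?l \<longleftrightarrow> ?r")
proof
  show "?l \<Longrightarrow> ?r" by (auto simp: in_hom_def hom_cat_sel hom2_def)
  assume r: ?r
  then have h: "hom2 B \<alpha> f g" by blast
  show ?l using r hom2D[OF h] by (auto simp: in_hom_def hom_cat_sel hom1_def hom2_def bicat_of_sel)
qed

lemma iso_iff:
  "iso (hom_cat B a b) \<alpha> f g \<longleftrightarrow>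
     invertible_2cell (M1 X) \<alpha> \<and> Dom (M1 X) (Suc 0) \<alpha> = f \<and> Cod (M1 X) (Suc 0) \<alpha> = g \<and>
     hom1 B f a b"
proof -
  have "hom1 B g a b" if "hom1 B f a b" "hom2 B \<alpha> f g"
    using that(1) hom2D[OF that(2)] by (simp add: hom1_def bicat_of_sel)
  then show ?thesis
    unfolding iso_def in_hom_iff invertible_2cell_def inverse_2cells_def hom_cat_sel
    by (auto simp: hom2_def bicat_of_sel)
qed

lemma iso2_iff:
  "iso2 B \<alpha> f g \<longleftrightarrow>
     invertible_2cell (M1 X) \<alpha> \<and> Dom (M1 X) (Suc 0) \<alpha> = f \<and> Cod (M1 X) (Suc 0) \<alpha> = g"
  unfolding iso2_def iso_iff
  by (auto simp: hom1_def bicat_of_sel invertible_2cell_def inverse_2cells_def A.typing)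

end

locale skeletal_weak_category = weak_omega_category +
  assumes skeletal: "skeletal 2 (M1 X)"
begin

lemma Dom_eq_Cod_above_2:
  assumes "c \<in> Cells (M1 X) (Suc (Suc (Suc k)))"
  shows "Dom (M1 X) (Suc (Suc k)) c = Cod (M1 X) (Suc (Suc k)) c"
proof -
  have "c \<in> identity_cells (M1 X) (Suc (Suc (Suc k)))"
    using skeletal[unfolded skeletal_def, rule_format, of "Suc (Suc (Suc k))"] assms by auto
  then show ?thesis by (auto simp: identity_cells_def A.typing)
qed

text \<open>
  The source of all equations between 2-cells: a bridge 3-cell from \<open>s\<close> to \<open>t\<close> exists, and its
  image under \<open>\<lambda>\<close> is an identity from \<open>\<lambda> s\<close> to \<open>\<lambda> t\<close>.
\<close>

lemma lam_eq_if_kap_eq: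
  assumes "s \<in> Cells (M2 X) (Suc (Suc 0))" "t \<in> Cells (M2 X) (Suc (Suc 0))"
    and "Dom (M2 X) (Suc 0) s = Dom (M2 X) (Suc 0) t" "Cod (M2 X) (Suc 0) s = Cod (M2 X) (Suc 0) t"
    and "kap X (Suc (Suc 0)) s = kap X (Suc (Suc 0)) t"
  shows "lam X (Suc (Suc 0)) s = lam X (Suc (Suc 0)) t"
proof -
  interpret R: bridge_relation "M2 X" "bridge X" by (rule bridge)
  obtain c where c: "(s, t, c) \<in> bridge X (Suc (Suc 0))"
    using bridge_if_kap_eq[of "Suc (Suc 0)" s t] assms by (auto simp: parallel_def)
  show ?thesis
    using Dom_eq_Cod_above_2[of "lam X (Suc (Suc (Suc 0))) c" 0] R.bridge_cells[OF c]
      R.bridge_Dom[OF c] R.bridge_Cod[OF c] by (simp add: calculus)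
qed

section \<open>The bicategory axioms\<close>

text \<open>
  Each equation below is proved by exhibiting its two sides as images under \<open>\<lambda>\<close> of diagrams built
  from \<open>\<rho>\<close> of the given cells. Since \<open>\<lambda>\<close> preserves composition and \<open>\<lambda> \<circ> \<rho> = 1\<close>, applying \<open>\<lambda>\<close>
  recovers the sides, even though \<open>\<rho>\<close> is not compatible with composition.
\<close>

lemma VComp_assoc:
  assumes "hom2 B \<alpha> f g" "hom2 B \<beta> g h" "hom2 B \<gamma> h k"
  shows "VComp B (VComp B \<alpha> \<beta>) \<gamma> =
    VComp B \<alpha> (VComp B \<beta> \<gamma>)"
  using lam_eq_if_kap_eq[of "(\<rho>2 \<alpha> \<bullet> \<rho>2 \<beta>) \<bullet> \<rho>2 \<gamma>" "\<rho>2 \<alpha> \<bullet> \<rho>2 \<beta> \<bullet> \<rho>2 \<gamma>"]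
  using assms[THEN hom2D(1)] assms[THEN hom2D(2)] assms[THEN hom2D(3)]
  by (simp add: calculus bicat_of_sel)

lemma VComp_Id2:
  assumes "hom2 B \<alpha> f g"
  shows "VComp B (Id2 B f) \<alpha> = \<alpha>"
    and "VComp B \<alpha> (Id2 B g) = \<alpha>"
  using lam_eq_if_kap_eq[of "Idn (M2 X) (Suc 0) (\<rho>1 f) \<bullet> \<rho>2 \<alpha>" "\<rho>2 \<alpha>"]
    lam_eq_if_kap_eq[of "\<rho>2 \<alpha> \<bullet> Idn (M2 X) (Suc 0) (\<rho>1 g)" "\<rho>2 \<alpha>"]
  using hom2D[OF assms] by (simp_all add: calculus bicat_of_sel)

lemma hom_VComp:
  assumes "hom2 B \<alpha> f g" "hom2 B \<beta> g h"
  shows "hom2 B (VComp B \<alpha> \<beta>) f h"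
  using hom2D[OF assms(1)] hom2D[OF assms(2)] by (simp add: calculus bicat_of_sel hom2_def)

lemma hom_Id2: "hom1 B f a b \<Longrightarrow> hom2 B (Id2 B f) f f"
  by (drule hom1D(1)) (simp add: calculus bicat_of_sel hom2_def)

lemma hom_HComp1:
  assumes "hom1 B f a b" "hom1 B g b c"
  shows "hom1 B (HComp1 B f g) a c"
  using assms[THEN hom1D(1)] assms[THEN hom1D(2)] assms[THEN hom1D(3)]
  by (simp add: calculus bicat_of_sel hom1_def)

lemma hom_HComp2:
  assumes "hom2 B \<alpha> f f'" "hom2 B \<beta> g g'" "Cod (M1 X) 0 f = Dom (M1 X) 0 g"
  shows "hom2 B (HComp2 B \<alpha> \<beta>)
    (HComp1 B f g) (HComp1 B f' g')"
  using hom2D[OF assms(1)] hom2D[OF assms(2)] assms(3) by (simp add: calculus bicat_of_sel hom2_def)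

lemma HComp2_VComp:
  assumes "hom2 B \<alpha> f f'" "hom2 B \<alpha>' f' f''"
    and "hom2 B \<beta> g g'" "hom2 B \<beta>' g' g''"
    and "Cod (M1 X) 0 f = Dom (M1 X) 0 g"
  shows "HComp2 B (VComp B \<alpha> \<alpha>') (VComp B \<beta> \<beta>') =
    VComp B (HComp2 B \<alpha> \<beta>) (HComp2 B \<alpha>' \<beta>')"
  using lam_eq_if_kap_eq[of "(\<rho>2 \<alpha> \<bullet> \<rho>2 \<alpha>') \<diamondop> (\<rho>2 \<beta> \<bullet> \<rho>2 \<beta>')" "(\<rho>2 \<alpha> \<diamondop> \<rho>2 \<beta>) \<bullet> (\<rho>2 \<alpha>' \<diamondop> \<rho>2 \<beta>')"]
  using assms(1-4)[THEN hom2D(1)] assms(1-4)[THEN hom2D(2)] assms(1-4)[THEN hom2D(3)]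
    assms(1-4)[THEN hom2D(4)] assms(1-4)[THEN hom2D(6)] assms(1-4)[THEN hom2D(7)] assms(5)
    assms(1-4)[THEN hom2D(5)]
  by (simp add: calculus bicat_of_sel)

lemma HComp2_Id2:
  assumes "hom1 B f a b" "hom1 B g b c"
  shows "HComp2 B (Id2 B f) (Id2 B g) =
    Id2 B (HComp1 B f g)"
  using lam_eq_if_kap_eq[of "Idn (M2 X) (Suc 0) (\<rho>1 f) \<diamondop> Idn (M2 X) (Suc 0) (\<rho>1 g)"
    "Idn (M2 X) (Suc 0) (\<rho>1 f \<star> \<rho>1 g)"]
  using assms[THEN hom1D(1)] assms[THEN hom1D(2)] assms[THEN hom1D(3)]
  by (simp add: calculus bicat_of_sel)

text \<open>
  The bridge cell in the opposite direction is the inverse: the composite and the identity are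
  parallel, and both are sent to an identity of the strict category.
\<close>

lemma iso2_lam_bridge:
  assumes "s \<in> Cells (M2 X) (Suc 0)" "t \<in> Cells (M2 X) (Suc 0)"
    and "Dom (M2 X) 0 s = Dom (M2 X) 0 t" "Cod (M2 X) 0 s = Cod (M2 X) 0 t"
    and "kap X (Suc 0) s = kap X (Suc 0) t"
  shows "iso2 B (lam X (Suc (Suc 0)) (br s t)) (lam X (Suc 0) s) (lam X (Suc 0) t)"
proof -
  have "inverse_2cells (M1 X) (lam X (Suc (Suc 0)) (br s t)) (lam X (Suc (Suc 0)) (br t s))"
    using lam_eq_if_kap_eq[of "br s t \<bullet> br t s" "Idn (M2 X) (Suc 0) s"]
      lam_eq_if_kap_eq[of "br t s \<bullet> br s t" "Idn (M2 X) (Suc 0) t"] assms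
    by (simp add: calculus inverse_2cells_def)
  then show ?thesis
    using assms by (auto simp: iso2_iff invertible_2cell_def calculus)
qed

lemma Assoc_iso:
  assumes "hom1 B f a b" "hom1 B g b c" "hom1 B h c d"
  shows "iso2 B (Assoc B f g h)
    (HComp1 B f (HComp1 B g h)) (HComp1 B (HComp1 B f g) h)"
  using iso2_lam_bridge[of "\<rho>1 f \<star> \<rho>1 g \<star> \<rho>1 h" "(\<rho>1 f \<star> \<rho>1 g) \<star> \<rho>1 h"]
  using assms[THEN hom1D(1)] assms[THEN hom1D(2)] assms[THEN hom1D(3)]
  by (simp add: calculus bicat_of_sel)

lemma LUnit_iso:
  assumes "hom1 B f a b"
  shows "iso2 B (LUnit B f)
    (HComp1 B (Id1 B a) f) f"
  using iso2_lam_bridge[of "Idn (M2 X) 0 (rho X 0 a) \<star> \<rho>1 f" "\<rho>1 f"] hom1D[OF assms]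
  by (simp add: calculus bicat_of_sel)

lemma RUnit_iso:
  assumes "hom1 B f a b"
  shows "iso2 B (RUnit B f)
    (HComp1 B f (Id1 B b)) f"
  using iso2_lam_bridge[of "\<rho>1 f \<star> Idn (M2 X) 0 (rho X 0 b)" "\<rho>1 f"] hom1D[OF assms]
  by (simp add: calculus bicat_of_sel)

lemma Assoc_natural:
  assumes "hom2 B \<alpha> f f'" "hom2 B \<beta> g g'" "hom2 B \<gamma> h h'"
    and "Cod (M1 X) 0 f = Dom (M1 X) 0 g" "Cod (M1 X) 0 g = Dom (M1 X) 0 h"
  shows "VComp B (HComp2 B \<alpha> (HComp2 B \<beta> \<gamma>)) (Assoc B f' g' h') =
    VComp B (Assoc B f g h) (HComp2 B (HComp2 B \<alpha> \<beta>) \<gamma>)"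
  using lam_eq_if_kap_eq[of
    "(\<rho>2 \<alpha> \<diamondop> \<rho>2 \<beta> \<diamondop> \<rho>2 \<gamma>) \<bullet> br (\<rho>1 f' \<star> \<rho>1 g' \<star> \<rho>1 h') ((\<rho>1 f' \<star> \<rho>1 g') \<star> \<rho>1 h')"
    "br (\<rho>1 f \<star> \<rho>1 g \<star> \<rho>1 h) ((\<rho>1 f \<star> \<rho>1 g) \<star> \<rho>1 h) \<bullet> ((\<rho>2 \<alpha> \<diamondop> \<rho>2 \<beta>) \<diamondop> \<rho>2 \<gamma>)"]
  using hom2D[OF assms(1)] hom2D[OF assms(2)] hom2D[OF assms(3)] assms(4-)
  by (simp add: calculus bicat_of_sel)

lemma LUnit_natural:
  assumes "hom2 B \<alpha> f f'" "Dom (M1 X) 0 f = a"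
  shows "VComp B (HComp2 B (Id2 B (Id1 B a)) \<alpha>)
      (LUnit B f') = VComp B (LUnit B f) \<alpha>"
  using lam_eq_if_kap_eq[of
    "(Idn (M2 X) (Suc 0) (Idn (M2 X) 0 (rho X 0 a)) \<diamondop> \<rho>2 \<alpha>) \<bullet>
       br (Idn (M2 X) 0 (rho X 0 a) \<star> \<rho>1 f') (\<rho>1 f')"
    "br (Idn (M2 X) 0 (rho X 0 a) \<star> \<rho>1 f) (\<rho>1 f) \<bullet> \<rho>2 \<alpha>"]
  using hom2D[OF assms(1)] assms(2) by (simp add: calculus bicat_of_sel)

lemma RUnit_natural:
  assumes "hom2 B \<alpha> f f'" "Cod (M1 X) 0 f = b"
  shows "VComp B (HComp2 B \<alpha> (Id2 B (Id1 B b)))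
      (RUnit B f') = VComp B (RUnit B f) \<alpha>"
  using lam_eq_if_kap_eq[of
    "(\<rho>2 \<alpha> \<diamondop> Idn (M2 X) (Suc 0) (Idn (M2 X) 0 (rho X 0 b))) \<bullet>
       br (\<rho>1 f' \<star> Idn (M2 X) 0 (rho X 0 b)) (\<rho>1 f')"
    "br (\<rho>1 f \<star> Idn (M2 X) 0 (rho X 0 b)) (\<rho>1 f) \<bullet> \<rho>2 \<alpha>"]
  using hom2D[OF assms(1)] assms(2) by (simp add: calculus bicat_of_sel)

text \<open>
  Unlike the pentagon this is an instance of the general principle, because \<open>\<rho>\<close> preserves
  identities: the associator at \<open>f\<close>, \<open>1\<close>, \<open>g\<close> has the same middle cell in \<open>M2\<close> as the two unit cells.
\<close>

lemma triangle:
  assumes "hom1 B f a b" "hom1 B g b c"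
  shows "VComp B (Assoc B f (Id1 B b) g)
      (HComp2 B (RUnit B f) (Id2 B g)) =
    HComp2 B (Id2 B f) (LUnit B g)"
  using lam_eq_if_kap_eq[of
    "br (\<rho>1 f \<star> Idn (M2 X) 0 (rho X 0 b) \<star> \<rho>1 g) ((\<rho>1 f \<star> Idn (M2 X) 0 (rho X 0 b)) \<star> \<rho>1 g) \<bullet>
       (br (\<rho>1 f \<star> Idn (M2 X) 0 (rho X 0 b)) (\<rho>1 f) \<diamondop> Idn (M2 X) (Suc 0) (\<rho>1 g))"
    "Idn (M2 X) (Suc 0) (\<rho>1 f) \<diamondop> br (Idn (M2 X) 0 (rho X 0 b) \<star> \<rho>1 g) (\<rho>1 g)"]
  using hom1D[OF assms(1)] hom1D[OF assms(2)] by (simp add: calculus bicat_of_sel)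

lemma category_hom_cat: "category (hom_cat B a b)"
proof
  fix f g h k \<alpha> \<beta> \<gamma>
  assume "in_hom (hom_cat B a b) \<alpha> f g"
  note \<alpha> = this[unfolded in_hom_iff, THEN conjunct1] this[unfolded in_hom_iff, THEN conjunct2]
  show "Comp (hom_cat B a b) (Ident (hom_cat B a b) f) \<alpha> = \<alpha>"
    "Comp (hom_cat B a b) \<alpha> (Ident (hom_cat B a b) g) = \<alpha>"
    using VComp_Id2[OF \<alpha>(1)] by (simp_all add: hom_cat_sel)
  assume "in_hom (hom_cat B a b) \<beta> g h"
  note \<beta> = this[unfolded in_hom_iff, THEN conjunct1]
  show "in_hom (hom_cat B a b) (Comp (hom_cat B a b) \<alpha> \<beta>) f h"
    using hom_VComp[OF \<alpha>(1) \<beta>] \<alpha>(2) by (simp add: in_hom_iff hom_cat_sel)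
  assume "in_hom (hom_cat B a b) \<gamma> h k"
  note \<gamma> = this[unfolded in_hom_iff, THEN conjunct1]
  show "Comp (hom_cat B a b) (Comp (hom_cat B a b) \<alpha> \<beta>) \<gamma> =
      Comp (hom_cat B a b) \<alpha> (Comp (hom_cat B a b) \<beta> \<gamma>)"
    using VComp_assoc[OF \<alpha>(1) \<beta> \<gamma>] by (simp add: hom_cat_sel)
qed (auto simp: hom_cat_sel in_hom_iff intro: hom_Id2)

theorem bicategory_bicat_of:
  assumes "pentagon_law B"
  shows "bicategory B"
proof (rule bicategory.intro)
  fix f g h f' g' h' f'' g'' a b c d \<alpha> \<beta> \<gamma> \<alpha>' \<beta>'
  show "f \<in> Ones B \<Longrightarrow> Src1 B f \<in> Obs B"
    "f \<in> Ones B \<Longrightarrow> Tgt1 B f \<in> Obs B"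
    "\<alpha> \<in> Twos B \<Longrightarrow> Src2 B \<alpha> \<in> Ones B"
    "\<alpha> \<in> Twos B \<Longrightarrow> Tgt2 B \<alpha> \<in> Ones B"
    "\<alpha> \<in> Twos B \<Longrightarrow>
      Src1 B (Src2 B \<alpha>) = Src1 B (Tgt2 B \<alpha>)"
    "\<alpha> \<in> Twos B \<Longrightarrow>
      Tgt1 B (Src2 B \<alpha>) = Tgt1 B (Tgt2 B \<alpha>)"
    "a \<in> Obs B \<Longrightarrow> hom1 B (Id1 B a) a a"
    by (simp_all add: bicat_of_sel hom1_def A.typing A.Dom_Dom A.Cod_Dom)
  show "category (hom_cat B a b)" by (rule category_hom_cat)
  show "hom1 B f a b \<Longrightarrow> hom1 B g b c \<Longrightarrow>
      hom1 B (HComp1 B f g) a c"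
    by (rule hom_HComp1)
  show "hom2 B \<alpha> f f' \<Longrightarrow> hom2 B \<beta> g g' \<Longrightarrow>
      Tgt1 B f = Src1 B g \<Longrightarrow>
      hom2 B (HComp2 B \<alpha> \<beta>)
        (HComp1 B f g) (HComp1 B f' g')"
    by (rule hom_HComp2) (simp_all add: bicat_of_sel)
  show "hom2 B \<alpha> f f' \<Longrightarrow> hom2 B \<alpha>' f' f'' \<Longrightarrow> hom2 B \<beta> g g' \<Longrightarrow>
      hom2 B \<beta>' g' g'' \<Longrightarrow> Tgt1 B f = Src1 B g \<Longrightarrow>
      HComp2 B (VComp B \<alpha> \<alpha>') (VComp B \<beta> \<beta>') =
      VComp B (HComp2 B \<alpha> \<beta>) (HComp2 B \<alpha>' \<beta>')"
    by (rule HComp2_VComp) (simp_all add: bicat_of_sel(4,5))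
  show "hom2 B \<alpha> f f' \<Longrightarrow> hom2 B \<beta> g g' \<Longrightarrow> hom2 B \<gamma> h h' \<Longrightarrow>
      Tgt1 B f = Src1 B g \<Longrightarrow> Tgt1 B g = Src1 B h \<Longrightarrow>
      VComp B (HComp2 B \<alpha> (HComp2 B \<beta> \<gamma>)) (Assoc B f' g' h') =
      VComp B (Assoc B f g h) (HComp2 B (HComp2 B \<alpha> \<beta>) \<gamma>)"
    by (rule Assoc_natural) (simp_all add: bicat_of_sel(4,5))
  show "hom2 B \<alpha> f f' \<Longrightarrow> Src1 B f = a \<Longrightarrow>
      VComp B (HComp2 B (Id2 B (Id1 B a)) \<alpha>)
        (LUnit B f') = VComp B (LUnit B f) \<alpha>"
    by (rule LUnit_natural) (simp_all add: bicat_of_sel(4,5))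
  show "hom2 B \<alpha> f f' \<Longrightarrow> Tgt1 B f = b \<Longrightarrow>
      VComp B (HComp2 B \<alpha> (Id2 B (Id1 B b)))
        (RUnit B f') = VComp B (RUnit B f) \<alpha>"
    by (rule RUnit_natural) (simp_all add: bicat_of_sel(4,5))
qed ((rule HComp2_Id2 Assoc_iso LUnit_iso RUnit_iso triangle assms; assumption)+)

end

section \<open>The homomorphism given by a pseudo-functor\<close>

lemma bihom_of_sel:
  "Map0 (bihom_of X Y F) = F1 F 0"
  "Map1 (bihom_of X Y F) = F1 F (Suc 0)"
  "Map2 (bihom_of X Y F) = F1 F (Suc (Suc 0))"
  "CompC (bihom_of X Y F) f g = lam Y (Suc (Suc 0)) (bridge_cell (bridge Y) (Suc 0)
     (Cmp (M2 Y) 0 (Suc 0) (F2 F (Suc 0) (rho X (Suc 0) f)) (F2 F (Suc 0) (rho X (Suc 0) g)))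
     (F2 F (Suc 0) (Cmp (M2 X) 0 (Suc 0) (rho X (Suc 0) f) (rho X (Suc 0) g))))"
  "UnitC (bihom_of X Y F) a = lam Y (Suc (Suc 0)) (bridge_cell (bridge Y) (Suc 0)
     (Idn (M2 Y) 0 (F2 F 0 (rho X 0 a))) (F2 F (Suc 0) (Idn (M2 X) 0 (rho X 0 a))))"
  by (simp_all add: bihom_of_def Let_def numeral_2_eq_2)

locale skeletal_pseudofunctor = omega_pseudofunctor X Y F +
  X: skeletal_weak_category X + Y: skeletal_weak_category Y
  for X :: "('a, 'b, 'c) weak_omega_cat" and Y :: "('d, 'e, 'f) weak_omega_cat"
    and F :: "('a, 'b, 'c, 'd, 'e, 'f) pseudofunctor"
begin

text \<open>
  A pseudo-functor preserves the structure of \<open>M2\<close> only after applying \<open>\<kappa>\<close>. For identities this is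
  inherited from \<open>F3\<close> being a morphism of omega graphs, for composites it is an axiom.
\<close>

lemma kap_F2_Idn:
  "a \<in> Cells (M2 X) i \<Longrightarrow>
    kap Y (Suc i) (F2 F (Suc i) (Idn (M2 X) i a)) = Idn (M3 Y) i (kap Y i (F2 F i a))"
  using F_kap[of "Idn (M2 X) i a" "Suc i"] F_kap[of a i] graph_morphismD(2)[OF F3]
  by (simp add: X.calculus)

lemma kap_F2_Cmp:
  "composable (M2 X) i (Suc i) a b \<Longrightarrow>
    kap Y (Suc i) (F2 F (Suc i) (Cmp (M2 X) i (Suc i) a b)) =
    Cmp (M3 Y) i (Suc i) (kap Y (Suc i) (F2 F (Suc i) a)) (kap Y (Suc i) (F2 F (Suc i) b))"
  using kap_F_Cmp[of i a b] globular_morphismD[OF F2]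
  by (simp add: X.P.composable_top Y.P.composable_top Y.lam_kap_Cmp)

text \<open>
  The rule for \<open>F1\<close> is oriented so that \<open>\<lambda> (F2 s)\<close> becomes \<open>F1 (\<lambda> s)\<close>: diagrams in the image of \<open>F2\<close>
  then evaluate to images of composites of \<open>X\<close>.
\<close>

lemmas functor_calculus = X.calculus Y.calculus kap_F2_Idn kap_F2_Cmp F_lam[symmetric]
  globular_morphismD[OF F1] globular_morphismD[OF F2]

lemma hom1_F1:
  "hom1 (bicat_of X) f a b \<Longrightarrow> hom1 (bicat_of Y) (F1 F (Suc 0) f) (F1 F 0 a) (F1 F 0 b)"
  by (auto simp: hom1_def bicat_of_sel functor_calculus)

lemma hom2_F1:
  "hom2 (bicat_of X) \<alpha> f g \<Longrightarrow>
    hom2 (bicat_of Y) (F1 F (Suc (Suc 0)) \<alpha>) (F1 F (Suc 0) f) (F1 F (Suc 0) g)"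
  by (auto simp: hom2_def bicat_of_sel functor_calculus)

text \<open>
  Strict preservation of identities and vertical composites, although \<open>F1\<close> is only a morphism of
  globular sets: the deviation lives in the strict category, where it vanishes.
\<close>

lemma F1_Id2:
  assumes "f \<in> Cells (M1 X) (Suc 0)"
  shows "F1 F (Suc (Suc 0)) (Idn (M1 X) (Suc 0) f) = Idn (M1 Y) (Suc 0) (F1 F (Suc 0) f)"
  using Y.lam_eq_if_kap_eq[of "F2 F (Suc (Suc 0)) (Idn (M2 X) (Suc 0) (rho X (Suc 0) f))"
    "Idn (M2 Y) (Suc 0) (F2 F (Suc 0) (rho X (Suc 0) f))"] assms
  by (simp add: functor_calculus)

lemma F1_VComp:
  assumes "hom2 (bicat_of X) \<alpha> f g" "hom2 (bicat_of X) \<beta> g h"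
  shows "F1 F (Suc (Suc 0)) (VComp (bicat_of X) \<alpha> \<beta>) =
    VComp (bicat_of Y) (F1 F (Suc (Suc 0)) \<alpha>) (F1 F (Suc (Suc 0)) \<beta>)"
  using Y.lam_eq_if_kap_eq[of
    "F2 F (Suc (Suc 0)) (Cmp (M2 X) (Suc 0) (Suc (Suc 0)) (rho X (Suc (Suc 0)) \<alpha>) (rho X (Suc (Suc 0)) \<beta>))"
    "Cmp (M2 Y) (Suc 0) (Suc (Suc 0)) (F2 F (Suc (Suc 0)) (rho X (Suc (Suc 0)) \<alpha>))
       (F2 F (Suc (Suc 0)) (rho X (Suc (Suc 0)) \<beta>))"]
    X.hom2D[OF assms(1)] X.hom2D[OF assms(2)]
  by (simp add: functor_calculus bicat_of_sel)

lemma hom_functor: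
  "cat_functor (hom_cat (bicat_of X) a b) (hom_cat (bicat_of Y) (F1 F 0 a) (F1 F 0 b))
    (F1 F (Suc 0)) (F1 F (Suc (Suc 0)))"
  by (intro cat_functor.intro X.category_hom_cat Y.category_hom_cat cat_functor_axioms.intro)
    (auto simp: X.in_hom_iff Y.in_hom_iff F1_VComp hom_cat_sel bicat_of_sel(9)
      dest: X.hom1D(1) intro: hom1_F1 hom2_F1 F1_Id2)

lemma CompC_iso:
  assumes "hom1 (bicat_of X) f a b" "hom1 (bicat_of X) g b c"
  shows "iso2 (bicat_of Y) (CompC (bihom_of X Y F) f g)
    (HComp1 (bicat_of Y) (F1 F (Suc 0) f) (F1 F (Suc 0) g))
    (F1 F (Suc 0) (HComp1 (bicat_of X) f g))"
  using Y.iso2_lam_bridge[of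
    "Cmp (M2 Y) 0 (Suc 0) (F2 F (Suc 0) (rho X (Suc 0) f)) (F2 F (Suc 0) (rho X (Suc 0) g))"
    "F2 F (Suc 0) (Cmp (M2 X) 0 (Suc 0) (rho X (Suc 0) f) (rho X (Suc 0) g))"]
    X.hom1D[OF assms(1)] X.hom1D[OF assms(2)]
  by (simp add: functor_calculus bicat_of_sel bihom_of_sel)

lemma UnitC_iso:
  assumes "a \<in> Cells (M1 X) 0"
  shows "iso2 (bicat_of Y) (UnitC (bihom_of X Y F) a)
    (Id1 (bicat_of Y) (F1 F 0 a)) (F1 F (Suc 0) (Id1 (bicat_of X) a))"
  using Y.iso2_lam_bridge[of "Idn (M2 Y) 0 (F2 F 0 (rho X 0 a))"
    "F2 F (Suc 0) (Idn (M2 X) 0 (rho X 0 a))"] assms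
  by (simp add: functor_calculus bicat_of_sel bihom_of_sel)

theorem homomorphism_bihom_of:
  assumes "pentagon_law (bicat_of X)" "pentagon_law (bicat_of Y)"
    and "comparison_coherent (bicat_of X) (bicat_of Y) (bihom_of X Y F)"
  shows "homomorphism (bicat_of X) (bicat_of Y) (bihom_of X Y F)"
proof (rule homomorphism.intro)
  show "bicategory (bicat_of X)" "bicategory (bicat_of Y)"
    using assms by (auto intro: X.bicategory_bicat_of Y.bicategory_bicat_of)
  show "homomorphism_axioms (bicat_of X) (bicat_of Y) (bihom_of X Y F)"
    using assms(3) hom_functor CompC_iso UnitC_iso globular_morphismD(1)[OF F1]
    by (intro homomorphism_axioms.intro)
      (simp_all add: bihom_of_sel(1-3) bicat_of_sel(1))
qed

end

section \<open>Internal equivalences are equivalences\<close>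

lemma el_cells: "f \<in> el M k \<Longrightarrow> f \<in> Cells M k"
  by (auto simp: el_def split: nat.splits)

lemma invertible_up_to_mono:
  assumes "\<And>k. S k \<subseteq> T k"
  shows "invertible_up_to M S k \<subseteq> invertible_up_to M T k"
proof (cases k)
  case (Suc m)
  have "S (Suc (Suc m)) \<subseteq> T (Suc (Suc m))" by (rule assms)
  then show ?thesis unfolding invertible_up_to_def Suc by (simp; blast)
qed (simp add: invertible_up_to_def)

lemma invertible_up_toE:
  assumes "f \<in> invertible_up_to M S (Suc m)"
  obtains g h h' where "f \<in> Cells M (Suc m)" "g \<in> Cells M (Suc m)"
    "Dom M m g = Cod M m f" "Cod M m g = Dom M m f"
    "h \<in> S (Suc (Suc m))" "h' \<in> S (Suc (Suc m))"
    "Dom M (Suc m) h = Cmp M m (Suc m) f g" "Cod M (Suc m) h = Idn M m (Dom M m f)"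
    "Dom M (Suc m) h' = Cmp M m (Suc m) g f" "Cod M (Suc m) h' = Idn M m (Cod M m f)"
  using assms unfolding invertible_up_to_def nat.case by blast

text \<open>
  Induction over the stages of the definition at one fixed dimension \<open>k\<close>. The case
  \<open>weak_inverse\<close> refers to internal equivalences of dimension \<open>k + 1\<close>, so information about these has
  to be supplied beforehand; in a 2-skeletal magma this regress ends at dimension 3.
\<close>

lemma Eq_induct [consumes 1, case_names el Cmp weak_inverse]:
  assumes "f \<in> Eq M k"
    and el: "\<And>f. f \<in> el M k \<Longrightarrow> Q f"
    and Cmp: "\<And>i f g. composable M i k f g \<Longrightarrow> Q f \<Longrightarrow> Q g \<Longrightarrow> Q (Cmp M i k f g)"
    and weak_inverse: "\<And>f. f \<in> invertible_up_to M (Eq M) k \<Longrightarrow> Q f"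
  shows "Q f"
proof -
  have "\<forall>f \<in> eq_stage M n k. Q f" for n
  proof (induction n)
    case 0
    have "Q f" if "f \<in> composites M (el M) k" for f
      using that by induction (auto intro: el Cmp)
    then show ?case by simp
  next
    case (Suc n)
    have le: "invertible_up_to M (eq_stage M n) k \<subseteq> invertible_up_to M (Eq M) k"
      by (rule invertible_up_to_mono) (auto simp: Eq_def)
    have "Q f" if "f \<in> composites M (\<lambda>k. eq_stage M n k \<union> invertible_up_to M (eq_stage M n) k) k" for f
      using that by induction (use Suc.IH le in \<open>auto intro: weak_inverse Cmp\<close>)
    then show ?case by simp
  qed
  then show ?thesis using assms(1) by (auto simp: Eq_def)
qed

lemma Eq_subset:
  assumes "f \<in> Eq M k" and "Cells M k \<subseteq> S"
    and "\<And>i f g. composable M i k f g \<Longrightarrow> f \<in> S \<Longrightarrow> g \<in> S \<Longrightarrow> Cmp M i k f g \<in> S"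
  shows "f \<in> S"
  using assms(1)
proof (induction rule: Eq_induct)
  case (weak_inverse f)
  then show ?case using assms(2) by (auto simp: invertible_up_to_def split: nat.splits)
qed (use assms in \<open>auto dest: el_cells\<close>)

lemma Idn_Eq: "a \<in> Cells M i \<Longrightarrow> Idn M i a \<in> Cells M (Suc i) \<Longrightarrow> Idn M i a \<in> Eq M (Suc i)"
proof -
  assume a: "a \<in> Cells M i" "Idn M i a \<in> Cells M (Suc i)"
  then have "Idn M i a \<in> el M (Suc i)"
    by (cases i) (auto simp: el_def identity_cells_def)
  then have "Idn M i a \<in> eq_stage M 0 (Suc i)" by (simp add: composites.base)
  then show ?thesis unfolding Eq_def by blast
qed

lemma hom_magma_sel:
  "Cells (hom_magma M m a b) j = {c \<in> Cells M (Suc m + j).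
     dom_it M m (Suc m + j) c = a \<and> cod_it M m (Suc m + j) c = b}"
  "Dom (hom_magma M m a b) j = Dom M (Suc m + j)"
  "Cod (hom_magma M m a b) j = Cod M (Suc m + j)"
  "Idn (hom_magma M m a b) j = Idn M (Suc m + j)"
  "Cmp (hom_magma M m a b) i j = Cmp M (Suc m + i) (Suc m + j)"
  by (simp_all add: hom_magma_def)

lemma hom_magma_it:
  "dom_it (hom_magma M m a b) i j c = dom_it M (Suc m + i) (Suc m + j) c"
  "cod_it (hom_magma M m a b) i j c = cod_it M (Suc m + i) (Suc m + j) c"
proof (induction j arbitrary: c)
  case 0
  { case 1 then show ?case by (cases m) simp_all next case 2 then show ?case by (cases m) simp_all }
qed (simp_all add: hom_magma_sel)

lemma hom_magma_composable:
  "composable (hom_magma M m a b) i j f g \<Longrightarrow> composable M (Suc m + i) (Suc m + j) f g"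
  by (simp add: composable_def hom_magma_it hom_magma_sel del: dom_it.simps cod_it.simps)

lemma Eq_cells: "omega_magma M \<Longrightarrow> f \<in> Eq M k \<Longrightarrow> f \<in> Cells M k"
  by (erule Eq_subset) (auto intro: omega_magma.Cmp_cells)

lemma Eq_hom_magma_cells:
  assumes "omega_magma M" "f \<in> Eq (hom_magma M m a b) k"
  shows "f \<in> Cells M (Suc m + k)"
proof (rule Eq_subset[OF assms(2)])
  fix i f g
  assume "composable (hom_magma M m a b) i k f g"
  then show "Cmp (hom_magma M m a b) i k f g \<in> Cells M (Suc m + k)"
    unfolding hom_magma_sel by (intro omega_magma.Cmp_cells[OF assms(1)] hom_magma_composable)
qed (auto simp: hom_magma_sel)

text \<open>
  In the free clique the composite of the bridge cells between \<open>s\<close> and \<open>t\<close> is parallel to the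
  identity of \<open>s\<close>, hence bridged with it one dimension higher. The image of that bridge has equal
  domain and codomain in \<open>N\<close>.
\<close>

lemma clique_bridge_inverse:
  assumes H: "magma_morphism Cl2 N H" and st: "parallel Cl2 k s t" "s \<noteq> t"
    and flat: "\<And>c. c \<in> Cells N (Suc (Suc k)) \<Longrightarrow> Dom N (Suc k) c = Cod N (Suc k) c"
  shows "Cmp N k (Suc k) (H (Suc k) (Br s t)) (H (Suc k) (Br t s)) = Idn N k (H k s)"
proof -
  let ?c = "Cp k (Br s t) (Br t s)"
  have w: "twf (Br s t)" "twf (Br t s)" "tdim s = k" "tdim t = k" "twf s"
    using st by (auto simp: parallel_Cl2 intro!: twf.Br)
  then have c: "twf ?c" by (intro twf.Cp) simp_all
  then have "twf (Br ?c (Idt s))" using w by (intro twf.Br twf.Idt) simp_all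
  then have b: "Br ?c (Idt s) \<in> Cells Cl2 (Suc (Suc k))" using w by simp
  note G = magma_morphismD(1)[OF H]
  note H' = globular_morphismD[OF graph_morphismD(1)[OF G]]
  have "H (Suc k) ?c = H (Suc k) (Idt s)"
    using flat[OF H'(1)[OF b]] H'(2)[OF b] H'(3)[OF b] by simp
  moreover have "composable Cl2 k (Suc k) (Br s t) (Br t s)"
    using c w by (simp add: composable_Cl2)
  ultimately show ?thesis
    using magma_morphismD(2)[OF H] graph_morphismD(2)[OF G, of s k] w by simp
qed

lemma parallel_Pt: "parallel Cl2 0 (Pt p) (Pt q)"
  by (simp add: parallel_Cl2 twf.Pt)

context skeletal_weak_category
begin

lemma invertible_Idn: "f \<in> Cells (M1 X) (Suc 0) \<Longrightarrow> invertible_2cell (M1 X) (Idn (M1 X) (Suc 0) f)"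
  using VComp_Id2(1)[of "Idn (M1 X) (Suc 0) f" f f]
  unfolding invertible_2cell_def inverse_2cells_def
  by (intro exI[of _ "Idn (M1 X) (Suc 0) f"]) (simp add: calculus hom2_def bicat_of_sel)

lemma inverse_2cellsD:
  assumes "inverse_2cells (M1 X) \<alpha> \<beta>"
  shows "hom2 B \<alpha> (Dom (M1 X) (Suc 0) \<alpha>) (Cod (M1 X) (Suc 0) \<alpha>)"
    and "hom2 B \<beta> (Cod (M1 X) (Suc 0) \<alpha>) (Dom (M1 X) (Suc 0) \<alpha>)"
    and "VComp B \<alpha> \<beta> = Id2 B (Dom (M1 X) (Suc 0) \<alpha>)"
    and "VComp B \<beta> \<alpha> = Id2 B (Cod (M1 X) (Suc 0) \<alpha>)"
  using assms by (simp_all add: inverse_2cells_def hom2_def bicat_of_sel)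

lemma inverse_2cellsI:
  assumes "hom2 B \<alpha> f g" "hom2 B \<beta> g f" "VComp B \<alpha> \<beta> = Id2 B f" "VComp B \<beta> \<alpha> = Id2 B g"
  shows "inverse_2cells (M1 X) \<alpha> \<beta>"
  using assms by (simp add: inverse_2cells_def hom2_def bicat_of_sel)

lemma inverse_VComp:
  assumes "inverse_2cells (M1 X) \<alpha> \<alpha>'" "inverse_2cells (M1 X) \<beta> \<beta>'"
    and eq: "Cod (M1 X) (Suc 0) \<alpha> = Dom (M1 X) (Suc 0) \<beta>"
  shows "inverse_2cells (M1 X) (VComp B \<alpha> \<beta>) (VComp B \<beta>' \<alpha>')"
proof -
  define f g h where "f = Dom (M1 X) (Suc 0) \<alpha>" "g = Dom (M1 X) (Suc 0) \<beta>" "h = Cod (M1 X) (Suc 0) \<beta>"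
  note a = inverse_2cellsD[OF assms(1), unfolded eq, folded f_g_h_def]
  note b = inverse_2cellsD[OF assms(2), folded f_g_h_def]
  have "VComp B (VComp B \<alpha> \<beta>) (VComp B \<beta>' \<alpha>') = VComp B \<alpha> (VComp B (VComp B \<beta> \<beta>') \<alpha>')"
    using VComp_assoc[OF a(1) b(1) hom_VComp[OF b(2) a(2)]] VComp_assoc[OF b(1,2) a(2)] by simp
  also have "\<dots> = Id2 B f"
    using VComp_Id2(1)[OF a(2)] a b by simp
  finally have 1: "VComp B (VComp B \<alpha> \<beta>) (VComp B \<beta>' \<alpha>') = Id2 B f" .
  have "VComp B (VComp B \<beta>' \<alpha>') (VComp B \<alpha> \<beta>) = VComp B \<beta>' (VComp B (VComp B \<alpha>' \<alpha>) \<beta>)"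
    using VComp_assoc[OF b(2) a(2) hom_VComp[OF a(1) b(1)]] VComp_assoc[OF a(2,1) b(1)] by simp
  also have "\<dots> = Id2 B h"
    using VComp_Id2(1)[OF b(1)] a b by simp
  finally show ?thesis
    by (rule inverse_2cellsI[OF hom_VComp[OF a(1) b(1)] hom_VComp[OF b(2) a(2)] 1])
qed

lemma inverse_HComp2:
  assumes "inverse_2cells (M1 X) \<alpha> \<alpha>'" "inverse_2cells (M1 X) \<beta> \<beta>'"
    and "Cod (M1 X) 0 (Dom (M1 X) (Suc 0) \<alpha>) = Dom (M1 X) 0 (Dom (M1 X) (Suc 0) \<beta>)"
  shows "inverse_2cells (M1 X) (HComp2 B \<alpha> \<beta>) (HComp2 B \<alpha>' \<beta>')"
proof -
  define f f' g g' where "f = Dom (M1 X) (Suc 0) \<alpha>" "f' = Cod (M1 X) (Suc 0) \<alpha>"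
    "g = Dom (M1 X) (Suc 0) \<beta>" "g' = Cod (M1 X) (Suc 0) \<beta>"
  note a = inverse_2cellsD[OF assms(1), folded f_f'_g_g'_def]
  note b = inverse_2cellsD[OF assms(2), folded f_f'_g_g'_def]
  have fg: "Cod (M1 X) 0 f = Dom (M1 X) 0 g" "Cod (M1 X) 0 f' = Dom (M1 X) 0 g'"
    using assms(3)[folded f_f'_g_g'_def] hom2D[OF a(1)] hom2D[OF b(1)] by simp_all
  have "HComp2 B (Id2 B f) (Id2 B g) = Id2 B (HComp1 B f g)"
    "HComp2 B (Id2 B f') (Id2 B g') = Id2 B (HComp1 B f' g')"
    using hom2D(4,5)[OF a(1)] hom2D(4,5)[OF b(1)] fg
      HComp2_Id2[of f "Dom (M1 X) 0 f" "Dom (M1 X) 0 g" g "Cod (M1 X) 0 g"]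
      HComp2_Id2[of f' "Dom (M1 X) 0 f'" "Dom (M1 X) 0 g'" g' "Cod (M1 X) 0 g'"]
    by (simp_all add: hom1_def bicat_of_sel)
  then show ?thesis
    using HComp2_VComp[OF a(1,2) b(1,2) fg(1)] HComp2_VComp[OF a(2,1) b(2,1) fg(2)]
    by (intro inverse_2cellsI[OF hom_HComp2[OF a(1) b(1) fg(1)] hom_HComp2[OF a(2) b(2) fg(2)]])
      (simp_all only: a(3,4) b(3,4))
qed

lemma invertible_VComp:
  "\<lbrakk>invertible_2cell (M1 X) \<alpha>; invertible_2cell (M1 X) \<beta>; Cod (M1 X) (Suc 0) \<alpha> = Dom (M1 X) (Suc 0) \<beta>\<rbrakk> \<Longrightarrow>
    invertible_2cell (M1 X) (VComp B \<alpha> \<beta>)"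
  unfolding invertible_2cell_def by (blast intro: inverse_VComp)

lemma invertible_HComp2:
  "\<lbrakk>invertible_2cell (M1 X) \<alpha>; invertible_2cell (M1 X) \<beta>;
    Cod (M1 X) 0 (Dom (M1 X) (Suc 0) \<alpha>) = Dom (M1 X) 0 (Dom (M1 X) (Suc 0) \<beta>)\<rbrakk> \<Longrightarrow>
    invertible_2cell (M1 X) (HComp2 B \<alpha> \<beta>)"
  unfolding invertible_2cell_def by (blast intro: inverse_HComp2)

text \<open>
  The cells \<open>h\<close> and \<open>h'\<close> are identities, so an inverse up to 3-cells is an inverse.
\<close>

lemma invertible_if_inverse_up_to_3cells:
  assumes "f \<in> Cells (M1 X) (Suc (Suc 0))" "g \<in> Cells (M1 X) (Suc (Suc 0))"
    and "Dom (M1 X) (Suc 0) g = Cod (M1 X) (Suc 0) f" "Cod (M1 X) (Suc 0) g = Dom (M1 X) (Suc 0) f"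
    and "h \<in> Cells (M1 X) (Suc (Suc (Suc 0)))" "h' \<in> Cells (M1 X) (Suc (Suc (Suc 0)))"
    and "Dom (M1 X) (Suc (Suc 0)) h = VComp B f g"
    and "Cod (M1 X) (Suc (Suc 0)) h = Idn (M1 X) (Suc 0) (Dom (M1 X) (Suc 0) f)"
    and "Dom (M1 X) (Suc (Suc 0)) h' = VComp B g f"
    and "Cod (M1 X) (Suc (Suc 0)) h' = Idn (M1 X) (Suc 0) (Cod (M1 X) (Suc 0) f)"
  shows "invertible_2cell (M1 X) f"
  using assms Dom_eq_Cod_above_2[of h 0] Dom_eq_Cod_above_2[of h' 0]
  unfolding invertible_2cell_def inverse_2cells_def by (auto simp: bicat_of_sel)

text \<open>
  Apart from identities, elementary internal equivalences of dimension 2 and those of dimension 1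
  in a hom magma are both given by such morphisms out of the free clique.
\<close>

lemma invertible_clique_image:
  assumes H: "magma_morphism Cl2 (hom_magma (M1 X) 0 a b) H"
  shows "invertible_2cell (M1 X) (H (Suc 0) (Cl2_c One Two))"
proof -
  let ?N = "hom_magma (M1 X) 0 a b" and ?u = "Br (Pt One) (Pt Two)" and ?v = "Br (Pt Two) (Pt One)"
  have flat: "Dom ?N (Suc 0) c = Cod ?N (Suc 0) c" if "c \<in> Cells ?N (Suc (Suc 0))" for c
    using that Dom_eq_Cod_above_2[of c 0] by (simp add: hom_magma_sel)
  note H' = globular_morphismD[OF graph_morphismD(1)[OF magma_morphismD(1)[OF H]]]
  have uv: "?u \<in> Cells Cl2 (Suc 0)" "?v \<in> Cells Cl2 (Suc 0)"
    by (auto intro!: twf.Br twf.Pt)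
  have "inverse_2cells (M1 X) (H (Suc 0) ?u) (H (Suc 0) ?v)"
    using clique_bridge_inverse[OF H parallel_Pt[of One Two] _ flat]
      clique_bridge_inverse[OF H parallel_Pt[of Two One] _ flat]
      H'[OF uv(1)] H'[OF uv(2)] H'(1)[of "Pt One" 0] H'(1)[of "Pt Two" 0]
    by (simp add: inverse_2cells_def hom_magma_sel twf.Pt)
  then show ?thesis by (auto simp: Cl2_c_eq invertible_2cell_def)
qed

lemma invertible_Eq_2:
  assumes "f \<in> Eq (M1 X) (Suc (Suc 0))"
  shows "invertible_2cell (M1 X) f"
  using assms
proof (induction rule: Eq_induct)
  case (el f)
  then show ?case
    by (auto simp: el_def identity_cells_def intro: invertible_Idn dest: invertible_clique_image)
next
  case (Cmp i f g)
  then have "i = 0 \<or> i = Suc 0" by (auto simp: composable_def)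
  then show ?case
    using Cmp invertible_VComp[of f g] invertible_HComp2[of f g]
    by (auto simp: A.composable_low bicat_of_sel)
next
  case (weak_inverse f)
  then show ?case
  proof (rule invertible_up_toE)
    fix g h h'
    assume "h \<in> Eq (M1 X) (Suc (Suc (Suc 0)))" "h' \<in> Eq (M1 X) (Suc (Suc (Suc 0)))"
    note Eq_cells[OF M1 this(1)] Eq_cells[OF M1 this(2)]
    moreover assume "f \<in> Cells (M1 X) (Suc (Suc 0))" "g \<in> Cells (M1 X) (Suc (Suc 0))"
      "Dom (M1 X) (Suc 0) g = Cod (M1 X) (Suc 0) f" "Cod (M1 X) (Suc 0) g = Dom (M1 X) (Suc 0) f"
      "Dom (M1 X) (Suc (Suc 0)) h = Cmp (M1 X) (Suc 0) (Suc (Suc 0)) f g"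
      "Cod (M1 X) (Suc (Suc 0)) h = Idn (M1 X) (Suc 0) (Dom (M1 X) (Suc 0) f)"
      "Dom (M1 X) (Suc (Suc 0)) h' = Cmp (M1 X) (Suc 0) (Suc (Suc 0)) g f"
      "Cod (M1 X) (Suc (Suc 0)) h' = Idn (M1 X) (Suc 0) (Cod (M1 X) (Suc 0) f)"
    ultimately show ?thesis
      by (intro invertible_if_inverse_up_to_3cells[of f g h h']) (simp_all add: bicat_of_sel)
  qed
qed

text \<open>
  The same conclusion for the internal equivalences of the hom magma; there only vertical
  composition of 2-cells occurs.
\<close>

lemma invertible_Eq_hom:
  assumes "f \<in> Eq (hom_magma (M1 X) 0 a b) (Suc 0)"
  shows "invertible_2cell (M1 X) f"
  using assms
proof (induction rule: Eq_induct)
  case (el f)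
  then show ?case
    by (auto simp: el_def identity_cells_def hom_magma_sel intro: invertible_Idn dest: invertible_clique_image)
next
  case (Cmp i f g)
  then have "i = 0" by (auto simp: composable_def)
  moreover from this have "composable (M1 X) (Suc 0) (Suc (Suc 0)) f g"
    using hom_magma_composable[OF Cmp(1)] by simp
  ultimately show ?case
    using Cmp(2,3) invertible_VComp[of f g]
    by (auto simp: A.composable_low bicat_of_sel hom_magma_sel)
next
  case (weak_inverse f)
  let ?N = "hom_magma (M1 X) 0 a b"
  obtain g h h' where g: "f \<in> Cells ?N (Suc 0)" "g \<in> Cells ?N (Suc 0)"
      "Dom ?N 0 g = Cod ?N 0 f" "Cod ?N 0 g = Dom ?N 0 f"
    and h: "h \<in> Eq ?N (Suc (Suc 0))" "h' \<in> Eq ?N (Suc (Suc 0))"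
      "Dom ?N (Suc 0) h = Cmp ?N 0 (Suc 0) f g" "Cod ?N (Suc 0) h = Idn ?N 0 (Dom ?N 0 f)"
      "Dom ?N (Suc 0) h' = Cmp ?N 0 (Suc 0) g f" "Cod ?N (Suc 0) h' = Idn ?N 0 (Cod ?N 0 f)"
    using weak_inverse by (rule invertible_up_toE)
  then show ?case
    using Eq_hom_magma_cells[OF M1 h(1)] Eq_hom_magma_cells[OF M1 h(2)]
    by (intro invertible_if_inverse_up_to_3cells[of f g h h'])
      (simp_all add: hom_magma_sel bicat_of_sel)
qed

definition isomorphic :: "'a \<Rightarrow> 'a \<Rightarrow> bool" (infix "\<cong>" 50) where
  "f \<cong> g \<longleftrightarrow> (\<exists>\<alpha>. iso2 B \<alpha> f g)"

lemma isomorphic_refl: "f \<in> Cells (M1 X) (Suc 0) \<Longrightarrow> f \<cong> f"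
  unfolding isomorphic_def iso2_iff
  by (intro exI[of _ "Idn (M1 X) (Suc 0) f"]) (simp add: invertible_Idn calculus)

lemma inverse_2cells_sym: "inverse_2cells (M1 X) \<alpha> \<beta> \<Longrightarrow> inverse_2cells (M1 X) \<beta> \<alpha>"
  by (simp add: inverse_2cells_def)

lemma isomorphic_sym: "f \<cong> g \<Longrightarrow> g \<cong> f"
  unfolding isomorphic_def iso2_iff invertible_2cell_def
  by (metis inverse_2cells_sym inverse_2cells_def)

lemma isomorphic_trans [trans]: "f \<cong> g \<Longrightarrow> g \<cong> h \<Longrightarrow> f \<cong> h"
proof -
  assume "f \<cong> g" "g \<cong> h"
  then obtain \<alpha> \<beta> where "iso2 B \<alpha> f g" "iso2 B \<beta> g h" by (auto simp: isomorphic_def)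
  then have ab: "invertible_2cell (M1 X) \<alpha>" "Dom (M1 X) (Suc 0) \<alpha> = f" "Cod (M1 X) (Suc 0) \<alpha> = g"
    "invertible_2cell (M1 X) \<beta>" "Dom (M1 X) (Suc 0) \<beta> = g" "Cod (M1 X) (Suc 0) \<beta> = h"
    by (simp_all add: iso2_iff)
  then have "\<alpha> \<in> Cells (M1 X) (Suc (Suc 0))" "\<beta> \<in> Cells (M1 X) (Suc (Suc 0))"
    by (auto simp: invertible_2cell_def inverse_2cells_def)
  then have "iso2 B (VComp B \<alpha> \<beta>) f h"
    using ab invertible_VComp[of \<alpha> \<beta>] by (simp add: iso2_iff bicat_of_sel A.Cmp_top)
  then show "f \<cong> h" by (auto simp: isomorphic_def)
qed

lemma isomorphic_HComp1:
  assumes "f \<cong> f'" "g \<cong> g'" "Cod (M1 X) 0 f = Dom (M1 X) 0 g"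
  shows "HComp1 B f g \<cong> HComp1 B f' g'"
proof -
  obtain \<alpha> \<beta> where ab: "iso2 B \<alpha> f f'" "iso2 B \<beta> g g'" using assms by (auto simp: isomorphic_def)
  then have h: "hom2 B \<alpha> f f'" "hom2 B \<beta> g g'"
    by (auto simp: iso2_iff invertible_2cell_def inverse_2cells_def hom2_def bicat_of_sel)
  have "invertible_2cell (M1 X) (HComp2 B \<alpha> \<beta>)"
    using ab assms(3) by (intro invertible_HComp2) (auto simp: iso2_iff)
  then show ?thesis
    using hom_HComp2[OF h assms(3)] by (auto simp: isomorphic_def iso2_iff hom2_def bicat_of_sel)
qed

lemma isomorphic_Assoc:
  assumes "hom1 B f a b" "hom1 B g b c" "hom1 B h c d"
  shows "HComp1 B f (HComp1 B g h) \<cong> HComp1 B (HComp1 B f g) h"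
  using Assoc_iso[OF assms] by (auto simp: isomorphic_def)

text \<open>
  Applied to \<open>f\<close>, \<open>g\<close> and to their weak inverses, this yields both halves of the statement that
  \<open>g' * f'\<close> is a weak inverse of \<open>f * g\<close>.
\<close>

lemma cancel_inner:
  assumes "hom1 B f a b" "hom1 B g b c" "hom1 B g' c b" "hom1 B f' b a"
    and "HComp1 B g g' \<cong> Id1 B b" "HComp1 B f f' \<cong> Id1 B a"
  shows "HComp1 B (HComp1 B f g) (HComp1 B g' f') \<cong> Id1 B a"
proof -
  note t = assms(1-4)[THEN hom1D(1)] assms(1-4)[THEN hom1D(2)] assms(1-4)[THEN hom1D(3)]
  have "HComp1 B (HComp1 B f g) (HComp1 B g' f') \<cong> HComp1 B f (HComp1 B g (HComp1 B g' f'))"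
    by (rule isomorphic_sym[OF isomorphic_Assoc[OF assms(1,2) hom_HComp1[OF assms(3,4)]]])
  also have "\<dots> \<cong> HComp1 B f (HComp1 B (HComp1 B g g') f')"
    by (rule isomorphic_HComp1[OF isomorphic_refl isomorphic_Assoc[OF assms(2-4)]])
      (use t in \<open>simp_all add: bicat_of_sel calculus\<close>)
  also have "\<dots> \<cong> HComp1 B f (HComp1 B (Id1 B b) f')"
    by (rule isomorphic_HComp1[OF isomorphic_refl isomorphic_HComp1[OF assms(5) isomorphic_refl]])
      (use t in \<open>simp_all add: bicat_of_sel calculus\<close>)
  also have "\<dots> \<cong> HComp1 B f f'"
  proof (rule isomorphic_HComp1[OF isomorphic_refl])
    show "HComp1 B (Id1 B b) f' \<cong> f'"
      using LUnit_iso[OF assms(4)] by (auto simp: isomorphic_def)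
  qed (use t hom1D[OF assms(4)] in \<open>simp_all add: bicat_of_sel calculus\<close>)
  also have "\<dots> \<cong> Id1 B a" by (rule assms(6))
  finally show ?thesis .
qed

lemma equivalence_1cell_iff:
  "equivalence_1cell B f a b \<longleftrightarrow> hom1 B f a b \<and>
     (\<exists>g. hom1 B g b a \<and> HComp1 B f g \<cong> Id1 B a \<and> HComp1 B g f \<cong> Id1 B b)"
  unfolding equivalence_1cell_def isomorphic_def by blast

lemma equivalence_endpoints:
  "equivalence_1cell B f a b \<Longrightarrow> equivalence_1cell B f (Dom (M1 X) 0 f) (Cod (M1 X) 0 f)"
  by (simp add: equivalence_1cell_iff) (metis hom1D(2,3))

lemma equivalence_HComp1:
  assumes "equivalence_1cell B f a b" "equivalence_1cell B g b c"
  shows "equivalence_1cell B (HComp1 B f g) a c"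
proof -
  obtain f' where f': "hom1 B f' b a" "HComp1 B f f' \<cong> Id1 B a" "HComp1 B f' f \<cong> Id1 B b"
    and f: "hom1 B f a b" using assms(1) by (auto simp: equivalence_1cell_iff)
  obtain g' where g': "hom1 B g' c b" "HComp1 B g g' \<cong> Id1 B b" "HComp1 B g' g \<cong> Id1 B c"
    and g: "hom1 B g b c" using assms(2) by (auto simp: equivalence_1cell_iff)
  show ?thesis
    unfolding equivalence_1cell_iff
    using hom_HComp1[OF f g] hom_HComp1[OF g'(1) f'(1)]
      cancel_inner[OF f g g'(1) f'(1) g'(2) f'(2)] cancel_inner[OF g'(1) f'(1) f g f'(3) g'(3)]
    by blast
qed

lemma equivalence_Id1:
  assumes "a \<in> Cells (M1 X) 0"
  shows "equivalence_1cell B (Id1 B a) a a"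
proof -
  have "hom1 B (Id1 B a) a a" using assms by (simp add: hom1_def bicat_of_sel calculus)
  then show ?thesis
    using LUnit_iso unfolding equivalence_1cell_iff isomorphic_def by blast
qed

text \<open>
  The 1-cells \<open>H c(1,2)\<close> and \<open>H c(2,1)\<close> are weakly inverse: the free clique bridges their composites
  with the identities in both directions, and these bridge 2-cells become invertible because their
  own composites are bridged with identities in dimension 3.
\<close>

lemma equivalence_clique_image:
  assumes H: "magma_morphism Cl2 (M1 X) H"
  shows "equivalence_1cell B (H (Suc 0) (Cl2_c One Two)) (H 0 (Pt One)) (H 0 (Pt Two))"
proof -
  note G = magma_morphismD(1)[OF H]
  note H' = globular_morphismD[OF graph_morphismD(1)[OF G]]
  have retract: "HComp1 B (H (Suc 0) (Br (Pt p) (Pt q))) (H (Suc 0) (Br (Pt q) (Pt p))) \<cong> Id1 B (H 0 (Pt p))"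
    if "p \<noteq> q" for p q
  proof -
    let ?s = "Cp 0 (Br (Pt p) (Pt q)) (Br (Pt q) (Pt p))" and ?t = "Idt (Pt p)"
    have s: "twf ?s" using that by (intro twf.Cp twf.Br) (auto intro: twf.Pt)
    then have st: "parallel Cl2 (Suc 0) ?s ?t" "parallel Cl2 (Suc 0) ?t ?s"
      by (auto simp: parallel_Cl2 intro: twf.Idt twf.Pt)
    then have w: "Br ?s ?t \<in> Cells Cl2 (Suc (Suc 0))" "Br ?t ?s \<in> Cells Cl2 (Suc (Suc 0))"
      by (auto simp: parallel_Cl2 intro!: twf.Br)
    have "inverse_2cells (M1 X) (H (Suc (Suc 0)) (Br ?s ?t)) (H (Suc (Suc 0)) (Br ?t ?s))"
      using clique_bridge_inverse[OF H st(1) _ Dom_eq_Cod_above_2]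
        clique_bridge_inverse[OF H st(2) _ Dom_eq_Cod_above_2] H'[OF w(1)] H'[OF w(2)]
      by (simp add: inverse_2cells_def)
    then have "iso2 B (H (Suc (Suc 0)) (Br ?s ?t)) (H (Suc 0) ?s) (H (Suc 0) ?t)"
      using H'[OF w(1)] by (auto simp: iso2_iff invertible_2cell_def)
    moreover have "H (Suc 0) ?s = HComp1 B (H (Suc 0) (Br (Pt p) (Pt q))) (H (Suc 0) (Br (Pt q) (Pt p)))"
      using magma_morphismD(2)[OF H, of 0 "Suc 0" "Br (Pt p) (Pt q)" "Br (Pt q) (Pt p)"] s
      by (simp add: composable_Cl2 bicat_of_sel)
    moreover have "H (Suc 0) ?t = Id1 B (H 0 (Pt p))"
      using graph_morphismD(2)[OF G, of "Pt p" 0] by (simp add: bicat_of_sel twf.Pt)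
    ultimately show ?thesis by (auto simp: isomorphic_def)
  qed
  have "hom1 B (H (Suc 0) (Br (Pt p) (Pt q))) (H 0 (Pt p)) (H 0 (Pt q))" if "p \<noteq> q" for p q
    using H'[of "Br (Pt p) (Pt q)" 0] H'(1)[of "Br (Pt p) (Pt q)" "Suc 0"] that
      twf.Br[OF twf.Pt[of p] twf.Pt[of q]]
    by (simp add: hom1_def bicat_of_sel)
  then show ?thesis
    using retract[of One Two] retract[of Two One] by (auto simp: equivalence_1cell_iff Cl2_c_eq)
qed

text \<open>
  In the inductive case the 2-cells witnessing weak invertibility are internal equivalences of
  dimension 2, which are isomorphisms by \<open>invertible_Eq_2\<close>.
\<close>

theorem equivalence_Eq_1:
  assumes "f \<in> Eq (M1 X) (Suc 0)"
  shows "equivalence_1cell B f (Dom (M1 X) 0 f) (Cod (M1 X) 0 f)"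
  using assms
proof (induction rule: Eq_induct)
  case (el f)
  then show ?case
    using equivalence_Id1 equivalence_clique_image[THEN equivalence_endpoints]
    by (auto simp: el_def identity_cells_def calculus bicat_of_sel)
next
  case (Cmp i f g)
  then have "i = 0" by (auto simp: composable_def)
  then show ?case
    using Cmp equivalence_HComp1[of f "Dom (M1 X) 0 f" "Cod (M1 X) 0 f" g "Cod (M1 X) 0 g"]
    by (simp add: bicat_of_sel A.composable_low A.Cmp_top)
next
  case (weak_inverse f)
  obtain g h h' where g: "f \<in> Cells (M1 X) (Suc 0)" "g \<in> Cells (M1 X) (Suc 0)"
      "Dom (M1 X) 0 g = Cod (M1 X) 0 f" "Cod (M1 X) 0 g = Dom (M1 X) 0 f"
    and h: "h \<in> Eq (M1 X) (Suc (Suc 0))" "h' \<in> Eq (M1 X) (Suc (Suc 0))"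
      "Dom (M1 X) (Suc 0) h = HComp1 B f g" "Cod (M1 X) (Suc 0) h = Id1 B (Dom (M1 X) 0 f)"
      "Dom (M1 X) (Suc 0) h' = HComp1 B g f" "Cod (M1 X) (Suc 0) h' = Id1 B (Cod (M1 X) 0 f)"
    using weak_inverse unfolding bicat_of_sel by (rule invertible_up_toE)
  have "iso2 B h (HComp1 B f g) (Id1 B (Dom (M1 X) 0 f))"
    "iso2 B h' (HComp1 B g f) (Id1 B (Cod (M1 X) 0 f))"
    using h invertible_Eq_2 by (auto simp: iso2_iff)
  moreover have "hom1 B f (Dom (M1 X) 0 f) (Cod (M1 X) 0 f)" "hom1 B g (Cod (M1 X) 0 f) (Dom (M1 X) 0 f)"
    using g by (auto simp: hom1_def bicat_of_sel)
  ultimately show ?case unfolding equivalence_1cell_def by blast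
qed

end

section \<open>Fully faithful and essentially surjective functors\<close>

text \<open>
  The quasi-inverse sends \<open>z\<close> to a chosen \<open>Go z\<close> with an isomorphism \<open>\<epsilon> z : Fo (Go z) \<rightarrow> z\<close>, and a
  morphism \<open>g\<close> to the unique preimage of its conjugate by \<open>\<epsilon>\<close>. The isomorphisms \<open>\<epsilon>\<close> form the
  counit, and the unit is the preimage of their inverses.
\<close>

lemma equivalence_if_fully_faithful_ess_surj:
  assumes "cat_functor C D Fo Fm"
    and bij: "\<And>x y. x \<in> Obj C \<Longrightarrow> y \<in> Obj C \<Longrightarrow>
      bij_betw Fm {f. in_hom C f x y} {g. in_hom D g (Fo x) (Fo y)}"
    and surj: "\<And>z. z \<in> Obj D \<Longrightarrow> \<exists>x \<in> Obj C. \<exists>f. iso D f (Fo x) z"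
  shows "equivalence_of_categories C D Fo Fm"
proof -
  interpret F: cat_functor C D Fo Fm by fact
  have "\<forall>z. \<exists>x e e'. z \<in> Obj D \<longrightarrow> x \<in> Obj C \<and> in_hom D e (Fo x) z \<and> in_hom D e' z (Fo x) \<and>
      Comp D e e' = Ident D (Fo x) \<and> Comp D e' e = Ident D z"
    using surj unfolding iso_def by metis
  then obtain Go \<epsilon> \<epsilon>' where G: "z \<in> Obj D \<Longrightarrow> Go z \<in> Obj C"
    and \<epsilon>: "z \<in> Obj D \<Longrightarrow> in_hom D (\<epsilon> z) (Fo (Go z)) z"
    and \<epsilon>': "z \<in> Obj D \<Longrightarrow> in_hom D (\<epsilon>' z) z (Fo (Go z))"
    and inv: "z \<in> Obj D \<Longrightarrow> Comp D (\<epsilon> z) (\<epsilon>' z) = Ident D (Fo (Go z))"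
      "z \<in> Obj D \<Longrightarrow> Comp D (\<epsilon>' z) (\<epsilon> z) = Ident D z" for z
    by metis
  have ex: "\<exists>f. in_hom C f x y \<and> Fm f = g"
    if "x \<in> Obj C" "y \<in> Obj C" "in_hom D g (Fo x) (Fo y)" for x y g
  proof -
    have "g \<in> Fm ` {f. in_hom C f x y}"
      using bij_betw_imp_surj_on[OF bij[OF that(1,2)]] that(3) by simp
    then show ?thesis by blast
  qed
  have faithful: "f = f'" if "in_hom C f x y" "in_hom C f' x y" "Fm f = Fm f'" for f f' x y
  proof -
    have "x \<in> Obj C" "y \<in> Obj C"
      using that(1) F.C.Source_Obj F.C.Target_Obj by (auto simp: in_hom_def)
    then show ?thesis
      using bij_betw_imp_inj_on[OF bij] that by (auto dest: inj_onD)
  qed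
  have objs: "x \<in> Obj D \<and> y \<in> Obj D" if "in_hom D g x y" for g x y
    using that F.D.Source_Obj F.D.Target_Obj by (auto simp: in_hom_def)
  have objsC: "x \<in> Obj C \<and> y \<in> Obj C" if "in_hom C g x y" for g x y
    using that F.C.Source_Obj F.C.Target_Obj by (auto simp: in_hom_def)
  let ?conj = "\<lambda>g x y. Comp D (Comp D (\<epsilon> x) g) (\<epsilon>' y)"
  have conj: "in_hom D (?conj g x y) (Fo (Go x)) (Fo (Go y))" if "in_hom D g x y" for g x y
    using that objs[OF that] \<epsilon> \<epsilon>' F.D.Comp_hom by blast
  define Gm where "Gm g = (SOME f. in_hom C f (Go (Source D g)) (Go (Target D g)) \<and>
      Fm f = ?conj g (Source D g) (Target D g))" for g
  have Gm: "in_hom C (Gm g) (Go x) (Go y) \<and> Fm (Gm g) = ?conj g x y" if g: "in_hom D g x y" for g x y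
  proof -
    have "Source D g = x" "Target D g = y" using g by (auto simp: in_hom_def)
    then have "Gm g = (SOME f. in_hom C f (Go x) (Go y) \<and> Fm f = ?conj g x y)"
      by (simp add: Gm_def)
    moreover have "\<exists>f. in_hom C f (Go x) (Go y) \<and> Fm f = ?conj g x y"
      using ex[OF _ _ conj[OF g]] G objs[OF g] by blast
    ultimately show ?thesis by (metis (mono_tags, lifting) someI_ex)
  qed
  \<comment> \<open>Naturality of the counit is the defining property of \<open>Gm\<close>, with \<open>\<epsilon>' y\<close> cancelled.\<close>
  have eps_nat: "Comp D (Fm (Gm g)) (\<epsilon> y) = Comp D (\<epsilon> x) g" if g: "in_hom D g x y" for g x y
  proof -
    have xy: "x \<in> Obj D" "y \<in> Obj D" using objs[OF g] by auto
    have eg: "in_hom D (Comp D (\<epsilon> x) g) (Fo (Go x)) y"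
      using F.D.Comp_hom[OF \<epsilon>[OF xy(1)] g] .
    show ?thesis
      using Gm[OF g] F.D.Comp_assoc[OF eg \<epsilon>'[OF xy(2)] \<epsilon>[OF xy(2)]] inv[OF xy(2)]
        F.D.Comp_Ident_right[OF eg] by simp
  qed
  have retract: "Comp D (Comp D u (\<epsilon> y)) (\<epsilon>' y) = u"
    if "in_hom D u w (Fo (Go y))" "y \<in> Obj D" for u w y
    using F.D.Comp_assoc[OF that(1) \<epsilon>[OF that(2)] \<epsilon>'[OF that(2)]] inv(1)[OF that(2)]
      F.D.Comp_Ident_right[OF that(1)] by simp
  \<comment> \<open>Together with faithfulness, this reduces functoriality of \<open>Gm\<close> to naturality of the counit.\<close>
  have cancel: "u = v" if "in_hom D u w (Fo (Go y))" "in_hom D v w (Fo (Go y))" "y \<in> Obj D"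
    "Comp D u (\<epsilon> y) = Comp D v (\<epsilon> y)" for u v w y
  proof -
    have "u = Comp D (Comp D u (\<epsilon> y)) (\<epsilon>' y)" by (rule retract[OF that(1,3), symmetric])
    also have "\<dots> = Comp D (Comp D v (\<epsilon> y)) (\<epsilon>' y)" by (rule arg_cong[OF that(4)])
    also have "\<dots> = v" by (rule retract[OF that(2,3)])
    finally show ?thesis .
  qed
  have G_functor: "cat_functor D C Go Gm"
  proof (intro cat_functor.intro cat_functor_axioms.intro F.C.category_axioms F.D.category_axioms)
    fix x y z f g
    show "x \<in> Obj D \<Longrightarrow> Go x \<in> Obj C" by (rule G)
    show "in_hom D f x y \<Longrightarrow> in_hom C (Gm f) (Go x) (Go y)" using Gm by blast
    show "Gm (Ident D x) = Ident C (Go x)" if x: "x \<in> Obj D"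
    proof (rule faithful)
      note i = F.D.Ident_hom[OF x]
      show "in_hom C (Gm (Ident D x)) (Go x) (Go x)" using Gm[OF i] by blast
      show "in_hom C (Ident C (Go x)) (Go x) (Go x)" using F.C.Ident_hom G x by blast
      show "Fm (Gm (Ident D x)) = Fm (Ident C (Go x))"
        using Gm[OF i] F.Fm_Ident[OF G[OF x]] F.D.Comp_Ident_right[OF \<epsilon>[OF x]] inv(1)[OF x] by simp
    qed
    show "Gm (Comp D f g) = Comp C (Gm f) (Gm g)" if f: "in_hom D f x y" and g: "in_hom D g y z"
    proof (rule faithful)
      note fg = F.D.Comp_hom[OF f g]
      note Gf = Gm[OF f, THEN conjunct1] and Gg = Gm[OF g, THEN conjunct1]
        and Gfg = Gm[OF fg, THEN conjunct1]
      show "in_hom C (Gm (Comp D f g)) (Go x) (Go z)" by (rule Gfg)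
      show h: "in_hom C (Comp C (Gm f) (Gm g)) (Go x) (Go z)" using F.C.Comp_hom[OF Gf Gg] .
      have z: "z \<in> Obj D" "y \<in> Obj D" "x \<in> Obj D" using objs[OF g] objs[OF f] by auto
      show "Fm (Gm (Comp D f g)) = Fm (Comp C (Gm f) (Gm g))"
      proof (rule cancel[OF F.Fm_hom[OF Gfg] F.Fm_hom[OF h] z(1)])
        have "Comp D (Fm (Comp C (Gm f) (Gm g))) (\<epsilon> z) = Comp D (Fm (Gm f)) (Comp D (Fm (Gm g)) (\<epsilon> z))"
          using F.Fm_Comp[OF Gf Gg] F.D.Comp_assoc[OF F.Fm_hom[OF Gf] F.Fm_hom[OF Gg] \<epsilon>[OF z(1)]] by simp
        also have "\<dots> = Comp D (Comp D (\<epsilon> x) f) g"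
          using eps_nat[OF g] eps_nat[OF f] F.D.Comp_assoc[OF F.Fm_hom[OF Gf] \<epsilon>[OF z(2)] g] by simp
        also have "\<dots> = Comp D (Fm (Gm (Comp D f g))) (\<epsilon> z)"
          using eps_nat[OF fg] F.D.Comp_assoc[OF \<epsilon>[OF z(3)] f g] by simp
        finally show "Comp D (Fm (Gm (Comp D f g))) (\<epsilon> z) = Comp D (Fm (Comp C (Gm f) (Gm g))) (\<epsilon> z)" ..
      qed
    qed
  qed
  have counit: "natural_iso D D (Fo \<circ> Go) (Fm \<circ> Gm) id id \<epsilon>"
    unfolding natural_iso_def iso_def using \<epsilon> \<epsilon>' inv eps_nat by fastforce
  have "\<forall>x. \<exists>e e'. x \<in> Obj C \<longrightarrow> in_hom C e x (Go (Fo x)) \<and> in_hom C e' (Go (Fo x)) x \<and>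
      Fm e = \<epsilon>' (Fo x) \<and> Fm e' = \<epsilon> (Fo x)"
  proof (intro allI)
    fix x show "\<exists>e e'. x \<in> Obj C \<longrightarrow> in_hom C e x (Go (Fo x)) \<and> in_hom C e' (Go (Fo x)) x \<and>
        Fm e = \<epsilon>' (Fo x) \<and> Fm e' = \<epsilon> (Fo x)"
      using ex[of x "Go (Fo x)" "\<epsilon>' (Fo x)"] ex[of "Go (Fo x)" x "\<epsilon> (Fo x)"] G \<epsilon> \<epsilon>' F.Fo_Obj by blast
  qed
  then obtain \<eta> \<eta>' where \<eta>: "x \<in> Obj C \<Longrightarrow> in_hom C (\<eta> x) x (Go (Fo x))"
    and \<eta>': "x \<in> Obj C \<Longrightarrow> in_hom C (\<eta>' x) (Go (Fo x)) x"
    and F\<eta>: "x \<in> Obj C \<Longrightarrow> Fm (\<eta> x) = \<epsilon>' (Fo x)" "x \<in> Obj C \<Longrightarrow> Fm (\<eta>' x) = \<epsilon> (Fo x)" for x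
    by metis
  have "natural_iso C C id id (Go \<circ> Fo) (Gm \<circ> Fm) \<eta>"
    unfolding natural_iso_def iso_def
  proof (intro conjI ballI allI impI)
    fix x assume x: "x \<in> Obj C"
    note z = F.Fo_Obj[OF x]
    show "in_hom C (\<eta> x) (id x) ((Go \<circ> Fo) x)" using \<eta>[OF x] by simp
    have 1: "Comp C (\<eta> x) (\<eta>' x) = Ident C x"
    proof (rule faithful[OF F.C.Comp_hom[OF \<eta>[OF x] \<eta>'[OF x]] F.C.Ident_hom[OF x]])
      show "Fm (Comp C (\<eta> x) (\<eta>' x)) = Fm (Ident C x)"
        using F.Fm_Comp[OF \<eta>[OF x] \<eta>'[OF x]] F\<eta>[OF x] F.Fm_Ident[OF x] inv[OF z] by simp
    qed
    have 2: "Comp C (\<eta>' x) (\<eta> x) = Ident C (Go (Fo x))"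
    proof (rule faithful[OF F.C.Comp_hom[OF \<eta>'[OF x] \<eta>[OF x]] F.C.Ident_hom[OF G[OF z]]])
      show "Fm (Comp C (\<eta>' x) (\<eta> x)) = Fm (Ident C (Go (Fo x)))"
        using F.Fm_Comp[OF \<eta>'[OF x] \<eta>[OF x]] F\<eta>[OF x] F.Fm_Ident[OF G[OF z]] inv[OF z] by simp
    qed
    show "\<exists>g. in_hom C g ((Go \<circ> Fo) x) (id x) \<and> Comp C (\<eta> x) g = Ident C (id x) \<and>
        Comp C g (\<eta> x) = Ident C ((Go \<circ> Fo) x)"
      using \<eta>'[OF x] 1 2 by auto
  next
    fix f x y assume f: "in_hom C f x y"
    have x: "x \<in> Obj C" and y: "y \<in> Obj C" using objsC[OF f] by auto
    note Ff = F.Fm_hom[OF f]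
    note Gf = Gm[OF Ff, THEN conjunct1]
    note z = F.Fo_Obj[OF x] and w = F.Fo_Obj[OF y]
    have "Comp C (\<eta> x) (Gm (Fm f)) = Comp C f (\<eta> y)"
    proof (rule faithful[OF F.C.Comp_hom[OF \<eta>[OF x] Gf] F.C.Comp_hom[OF f \<eta>[OF y]]])
      have l: "Fm (Comp C (\<eta> x) (Gm (Fm f))) = Comp D (\<epsilon>' (Fo x)) (Fm (Gm (Fm f)))"
        and r: "Fm (Comp C f (\<eta> y)) = Comp D (Fm f) (\<epsilon>' (Fo y))"
        using F.Fm_Comp[OF \<eta>[OF x] Gf] F.Fm_Comp[OF f \<eta>[OF y]] F\<eta> x y by simp_all
      have "Comp D (\<epsilon>' (Fo x)) (Fm (Gm (Fm f))) = Comp D (Comp D (\<epsilon>' (Fo x)) (Comp D (\<epsilon> (Fo x)) (Fm f))) (\<epsilon>' (Fo y))"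
        using Gm[OF Ff] F.D.Comp_assoc[OF \<epsilon>'[OF z] F.D.Comp_hom[OF \<epsilon>[OF z] Ff] \<epsilon>'[OF w]] by simp
      also have "Comp D (\<epsilon>' (Fo x)) (Comp D (\<epsilon> (Fo x)) (Fm f)) = Fm f"
        using F.D.Comp_assoc[OF \<epsilon>'[OF z] \<epsilon>[OF z] Ff] inv[OF z] F.D.Comp_Ident_left[OF Ff] by simp
      finally show "Fm (Comp C (\<eta> x) (Gm (Fm f))) = Fm (Comp C f (\<eta> y))" using l r by simp
    qed
    then show "Comp C (\<eta> x) ((Gm \<circ> Fm) f) = Comp C (id f) (\<eta> y)" by simp
  qed
  then show ?thesis
    unfolding equivalence_of_categories_def using G_functor counit \<open>cat_functor C D Fo Fm\<close> by blast
qed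

section \<open>From weak equivalences to biequivalences\<close>

text \<open>
  Surjectivity on classes in terms of representatives. Reflexivity of \<open>eq_rel N\<close> at \<open>b\<close> puts \<open>b\<close> into
  its own class, and thereby into the image of some class.
\<close>

lemma Pi0_map_surj:
  assumes "bij_betw (Pi0_map N \<phi>) (Pi0 M) (Pi0 N)" and b: "b \<in> Cells N 0" "(b, b) \<in> eq_rel N"
  obtains a where "a \<in> Cells M 0" "(\<phi> a, b) \<in> eq_rel N"
proof -
  have "eq_rel N `` {b} \<in> Pi0 N" using b by (auto simp: Pi0_def quotient_def)
  then obtain C where C: "C \<in> Pi0 M" "Pi0_map N \<phi> C = eq_rel N `` {b}"
    using bij_betw_imp_surj_on[OF assms(1)] by (metis imageE)
  then have "b \<in> Pi0_map N \<phi> C" using b by blast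
  then obtain a where "a \<in> C" "(\<phi> a, b) \<in> eq_rel N" by (auto simp: Pi0_map_def)
  moreover have "C \<subseteq> Cells M 0" using C(1) by (auto simp: Pi0_def quotient_def eq_rel_def)
  ultimately show ?thesis using that by blast
qed

lemma bij_betw_if_eq_rel_Id:
  assumes bij: "bij_betw (Pi0_map N \<phi>) (Pi0 M) (Pi0 N)"
    and M: "eq_rel M = Id_on (Cells M 0)" and N: "eq_rel N = Id_on (Cells N 0)"
    and \<phi>: "\<And>a. a \<in> Cells M 0 \<Longrightarrow> \<phi> a \<in> Cells N 0"
  shows "bij_betw \<phi> (Cells M 0) (Cells N 0)"
proof (rule bij_betw_imageI)
  have singleton: "Pi0_map N \<phi> {a} = {\<phi> a}" "{a} \<in> Pi0 M" if "a \<in> Cells M 0" for a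
    using that \<phi> by (auto simp: Pi0_map_def Pi0_def quotient_def M N)
  show "inj_on \<phi> (Cells M 0)"
  proof (rule inj_onI)
    fix a b assume "a \<in> Cells M 0" "b \<in> Cells M 0" "\<phi> a = \<phi> b"
    then show "a = b" using inj_onD[OF bij_betw_imp_inj_on[OF bij], of "{a}" "{b}"] singleton by simp
  qed
  show "\<phi> ` Cells M 0 = Cells N 0"
  proof (intro equalityI subsetI)
    fix b assume "b \<in> Cells N 0"
    then obtain a where "a \<in> Cells M 0" "(\<phi> a, b) \<in> eq_rel N"
      using Pi0_map_surj[OF bij, of b] by (auto simp: N)
    then show "b \<in> \<phi> ` Cells M 0" by (auto simp: N)
  qed (use \<phi> in auto)
qed

context skeletal_weak_category
begin

text \<open>
  Internal equivalences between 2-cells are 3-cells and so have equal domain and codomain;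
  conversely identities are internal equivalences.
\<close>

lemma eq_rel_hom_2:
  "eq_rel (hom_magma (M1 X) (Suc 0) f g) = Id_on (Cells (hom_magma (M1 X) (Suc 0) f g) 0)"
proof -
  let ?N = "hom_magma (M1 X) (Suc 0) f g"
  have "Dom ?N 0 c = Cod ?N 0 c" if "c \<in> Eq ?N (Suc 0)" for c
    using Eq_hom_magma_cells[OF M1 that] Dom_eq_Cod_above_2[of c 0] by (simp add: hom_magma_sel)
  moreover have "\<exists>c \<in> Eq ?N (Suc 0). Dom ?N 0 c = \<alpha> \<and> Cod ?N 0 c = \<alpha>" if "\<alpha> \<in> Cells ?N 0" for \<alpha>
    using that Idn_Eq[of \<alpha> ?N 0] by (auto simp: hom_magma_sel A.typing intro!: bexI[of _ "Idn ?N 0 \<alpha>"])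
  ultimately show ?thesis by (fastforce simp: eq_rel_def)
qed

lemma cells_hom_magma:
  "Cells (hom_magma (M1 X) 0 a b) 0 = {f. hom1 B f a b}"
  "Cells (hom_magma (M1 X) (Suc 0) f g) 0 = {\<alpha>. hom2 B \<alpha> f g}"
  by (auto simp: hom_magma_sel hom1_def hom2_def bicat_of_sel)

lemma eq_rel_hom_1_refl:
  assumes "hom1 B f a b"
  shows "(f, f) \<in> eq_rel (hom_magma (M1 X) 0 a b)"
  using Idn_Eq[of f "hom_magma (M1 X) 0 a b" 0] hom1D[OF assms]
  by (auto simp: eq_rel_def hom_magma_sel A.typing intro!: bexI[of _ "Idn (M1 X) (Suc 0) f"])

lemma eq_rel_hom_1_iso:
  assumes "(f, g) \<in> eq_rel (hom_magma (M1 X) 0 a b)"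
  shows "\<exists>\<alpha>. iso (hom_cat B a b) \<alpha> f g"
  using assms invertible_Eq_hom[of _ a b]
  by (auto simp: eq_rel_def cells_hom_magma(1) iso_iff hom_magma_sel(2,3))

lemma eq_rel_refl: "a \<in> Cells (M1 X) 0 \<Longrightarrow> (a, a) \<in> eq_rel (M1 X)"
  using Idn_Eq[of a "M1 X" 0] by (auto simp: eq_rel_def A.typing intro!: bexI[of _ "Idn (M1 X) 0 a"])

end

theorem theorem55:
  fixes X :: "('a, 'b, 'c) weak_omega_cat"
    and Y :: "('d, 'e, 'f) weak_omega_cat"
    and F :: "('a, 'b, 'c, 'd, 'e, 'f) pseudofunctor"
  assumes "omega_pseudofunctor X Y F"
    and "weak_equivalence X Y F"
    and "skeletal 2 (M1 X)" and "skeletal 2 (M1 Y)"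
  shows "surjective_up_to_equivalence (bicat_of X) (bicat_of Y) (bihom_of X Y F) \<and>
    equivalence_on_homs (bicat_of X) (bicat_of Y) (bihom_of X Y F) \<and>
    (pentagon_law (bicat_of X) \<and> pentagon_law (bicat_of Y) \<and>
       comparison_coherent (bicat_of X) (bicat_of Y) (bihom_of X Y F) \<longrightarrow>
     biequivalence (bicat_of X) (bicat_of Y) (bihom_of X Y F))"
proof -
  interpret omega_pseudofunctor X Y F by fact
  interpret skeletal_pseudofunctor X Y F
    by unfold_locales (fact assms)+
  have bij: "bij_betw (Pi0_map (M1 Y) (F1 F 0)) (Pi0 (M1 X)) (Pi0 (M1 Y))"
    and bij_hom: "\<And>m a b. a \<in> Cells (M1 X) m \<Longrightarrow> b \<in> Cells (M1 X) m \<Longrightarrow>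
        bij_betw (Pi0_map (hom_magma (M1 Y) m (F1 F m a) (F1 F m b)) (F1 F (Suc m)))
          (Pi0 (hom_magma (M1 X) m a b))
          (Pi0 (hom_magma (M1 Y) m (F1 F m a) (F1 F m b)))"
    using assms(2) unfolding weak_equivalence_def by blast+
  have surjective: "surjective_up_to_equivalence (bicat_of X) (bicat_of Y) (bihom_of X Y F)"
    unfolding surjective_up_to_equivalence_def bihom_of_sel bicat_of_sel
  proof
    fix b assume "b \<in> Cells (M1 Y) 0"
    then obtain a where a: "a \<in> Cells (M1 X) 0" "(F1 F 0 a, b) \<in> eq_rel (M1 Y)"
      using Pi0_map_surj[OF bij] Y.eq_rel_refl by blast
    then obtain f where "f \<in> Eq (M1 Y) (Suc 0)" "Dom (M1 Y) 0 f = F1 F 0 a" "Cod (M1 Y) 0 f = b"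
      by (auto simp: eq_rel_def)
    then show "\<exists>a \<in> Cells (M1 X) 0. \<exists>f. equivalence_1cell (bicat_of Y) f (F1 F 0 a) b"
      using a(1) Y.equivalence_Eq_1 by metis
  qed
  have homs: "equivalence_on_homs (bicat_of X) (bicat_of Y) (bihom_of X Y F)"
    unfolding equivalence_on_homs_def bihom_of_sel bicat_of_sel(1)
  proof (intro ballI equivalence_if_fully_faithful_ess_surj)
    fix a b assume ab: "a \<in> Cells (M1 X) 0" "b \<in> Cells (M1 X) 0"
    show "cat_functor (hom_cat (bicat_of X) a b) (hom_cat (bicat_of Y) (F1 F 0 a) (F1 F 0 b))
        (F1 F (Suc 0)) (F1 F (Suc (Suc 0)))"
      by (rule hom_functor)
    show "bij_betw (F1 F (Suc (Suc 0))) {\<alpha>. in_hom (hom_cat (bicat_of X) a b) \<alpha> f g}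
        {\<alpha>. in_hom (hom_cat (bicat_of Y) (F1 F 0 a) (F1 F 0 b)) \<alpha> (F1 F (Suc 0) f) (F1 F (Suc 0) g)}"
      if "f \<in> Obj (hom_cat (bicat_of X) a b)" "g \<in> Obj (hom_cat (bicat_of X) a b)" for f g
    proof -
      have h: "hom1 (bicat_of X) f a b" "hom1 (bicat_of X) g a b"
        using that by (simp_all add: hom_cat_sel)
      then have "bij_betw (F1 F (Suc (Suc 0))) {\<alpha>. hom2 (bicat_of X) \<alpha> f g}
          {\<alpha>. hom2 (bicat_of Y) \<alpha> (F1 F (Suc 0) f) (F1 F (Suc 0) g)}"
        using bij_betw_if_eq_rel_Id[OF bij_hom[of f "Suc 0" g] X.eq_rel_hom_2 Y.eq_rel_hom_2] hom2_F1
        by (auto simp: X.cells_hom_magma Y.cells_hom_magma dest: X.hom1D(1))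
      then show ?thesis
        using h(1) hom1_F1[OF h(1)] by (simp add: X.in_hom_iff Y.in_hom_iff)
    qed
    show "\<exists>f \<in> Obj (hom_cat (bicat_of X) a b). \<exists>\<alpha>.
        iso (hom_cat (bicat_of Y) (F1 F 0 a) (F1 F 0 b)) \<alpha> (F1 F (Suc 0) f) g"
      if "g \<in> Obj (hom_cat (bicat_of Y) (F1 F 0 a) (F1 F 0 b))" for g
    proof -
      have g: "hom1 (bicat_of Y) g (F1 F 0 a) (F1 F 0 b)" using that by (simp add: hom_cat_sel)
      then obtain f where "hom1 (bicat_of X) f a b"
        "(F1 F (Suc 0) f, g) \<in> eq_rel (hom_magma (M1 Y) 0 (F1 F 0 a) (F1 F 0 b))"
        using Pi0_map_surj[OF bij_hom[OF ab], of g] Y.eq_rel_hom_1_refl[OF g]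
        by (auto simp: X.cells_hom_magma Y.cells_hom_magma)
      then show ?thesis using Y.eq_rel_hom_1_iso by (auto simp: hom_cat_sel)
    qed
  qed
  show ?thesis
    using surjective homs homomorphism_bihom_of unfolding biequivalence_def by blast
qed

end
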